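(* Consider the rank-1 inhomogeneous random graph on $n$ vertices with i.i.d. weights having density $\rho(h)=h^{-\tau}l(h)$, $h\ge1$, where $\tau\in(2,3)$ and $l$ is slowly varying, with mean weight $\mu$ and connection probability $p(h,h')=\min\{hh'/(\mu n),1\}$. For every fixed even integer $k\ge 4$, the average number $C_k(n)$ of cycles of size $k$ satisfies $$C_k(n)\gtrsim n^k\left(\overline F(\sqrt n)\right)^k\int_{\sqrt{n\mu}}^{n\mu}\frac1h\,\frac{l^{k/2}(h)\,l^{k/2}(n\mu/h)}{l^k(\sqrt{n\mu})}\,dh .$$
   Context: Model: the graph has $n$ vertices with i.i.d. weights $H_1,\dots,H_n$ with density $\rho$ on $[1,\infty)$; conditionally on the weights, each pair of vertices $i\neq j$ is connected by an edge independently with probability $p(H_i,H_j)=\min\{H_iH_j/(\mu n),1\}$, where $\mu=\mathbb E[H_1]$. $\overline F(h)=\mathbb P(H_1>h)$ is the tail of the weight distribution. A function $l$ is slowly varying if $l(ch)/l(h)\to 1$ as $h\to\infty$ for every fixed $0<c<\infty$. $l^{a}$ denotes the $a$-th power of $l$. The average number of $k$-cycles is $C_k(n)=\frac{k!}{2k}\binom nk\,\mathbb P(C_k)$, where $\mathbb P(C_k)=\mathbb E\big[\prod_{i=1}^{k}p(H_i,H_{i+1})\big]$ (with index $k+1$ read as $1$) is the probability that $k$ given vertices, in a given cyclic order, form a cycle. Notation: $g_1(n)\gtrsim g_2(n)$ means that there exists a constant $C>0$ such that $\liminf_{n\to\infty}g_1(n)/g_2(n)\ge C$.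
   Formalization: When the integral diverges (possible if l^{k/2} is not integrable on bounded intervals, where the bound would be infinite and the claim false), the right-hand side is read as 0; whenever the integral is finite the claim is as stated. *)

theory Defs
  imports "HOL-Probability.Probability"
begin

definition slowly_varying :: "(real \<Rightarrow> real) \<Rightarrow> bool" where
  "slowly_varying l \<longleftrightarrow> (\<forall>c>0. ((\<lambda>h. l (c * h) / l h) \<longlongrightarrow> 1) at_top)"

definition weight_density :: "real \<Rightarrow> (real \<Rightarrow> real) \<Rightarrow> real \<Rightarrow> real" where
  "weight_density \<tau> l h = (if 1 \<le> h then h powr (- \<tau>) * l h else 0)"

definition tail :: "'a measure \<Rightarrow> ('a \<Rightarrow> real) \<Rightarrow> real \<Rightarrow> real" where
  "tail M X h = measure M {\<omega> \<in> space M. X \<omega> > h}"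

definition conn_prob :: "real \<Rightarrow> nat \<Rightarrow> real \<Rightarrow> real \<Rightarrow> real" where
  "conn_prob \<mu> n h h' = min (h * h' / (\<mu> * real n)) 1"

definition vertex_pairs :: "nat \<Rightarrow> nat set set" where
  "vertex_pairs n = {e. e \<subseteq> {..<n} \<and> card e = 2}"

text \<open>
  The law of the edge set of the graph on the vertices \<open>0, \<dots>, n - 1\<close>, conditionally on the
  weights \<open>w 0, \<dots>, w (n - 1)\<close>: the pairs are independent Bernoulli variables. Since
  \<^const>\<open>conn_prob\<close> is symmetric in the two weights, the use of \<^const>\<open>Min\<close> and \<^const>\<open>Max\<close> to
  name the end points of a pair is immaterial.
\<close>

definition graph_pmf :: "real \<Rightarrow> nat \<Rightarrow> (nat \<Rightarrow> real) \<Rightarrow> nat set set pmf" where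
  "graph_pmf \<mu> n w = map_pmf Collect (Pi_pmf (vertex_pairs n) False
     (\<lambda>e. bernoulli_pmf (conn_prob \<mu> n (w (Min e)) (w (Max e)))))"

definition cycle_edges :: "nat list \<Rightarrow> nat set set" where
  "cycle_edges xs = (\<lambda>i. {xs ! i, xs ! (Suc i mod length xs)}) ` {..<length xs}"

text \<open>A cycle is identified with its set of edges, so that it has neither a starting point nor an
  orientation.\<close>

definition cycles :: "nat \<Rightarrow> nat \<Rightarrow> nat set set set" where
  "cycles n k = cycle_edges ` {xs. length xs = k \<and> distinct xs \<and> set xs \<subseteq> {..<n}}"

definition cycle_count :: "nat \<Rightarrow> nat \<Rightarrow> nat set set \<Rightarrow> nat" where
  "cycle_count n k G = card {c \<in> cycles n k. c \<subseteq> G}"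

text \<open>
  The weight of vertex \<open>i\<close> is the random variable \<open>H i\<close> on \<open>M\<close>. The average is taken first over
  the edges given the weights, then over the weights. The lemma \<open>avg_cycles_eq\<close> below gives the
  closed form \<open>k! / (2k) \<cdot> (n choose k) \<cdot> P(C\<^sub>k)\<close>.
\<close>

definition avg_cycles :: "'a measure \<Rightarrow> (nat \<Rightarrow> 'a \<Rightarrow> real) \<Rightarrow> nat \<Rightarrow> nat \<Rightarrow> real" where
  "avg_cycles M H k n =
     (LINT \<omega>|M. measure_pmf.expectation
        (graph_pmf (integral\<^sup>L M (H 0)) n (\<lambda>i. H i \<omega>)) (\<lambda>G. real (cycle_count n k G)))"

definition cycle_prob :: "'a measure \<Rightarrow> (nat \<Rightarrow> 'a \<Rightarrow> real) \<Rightarrow> nat \<Rightarrow> nat \<Rightarrow> real" where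
  "cycle_prob M H k n =
     (LINT \<omega>|M. (\<Prod>i<k. conn_prob (integral\<^sup>L M (H 0)) n (H i \<omega>) (H (Suc i mod k) \<omega>)))"

text \<open>
  The quotient is formed in the extended reals, where \<open>x / 0 = \<infinity>\<close> for \<open>x > 0\<close>; in the reals
  \<open>x / 0\<close> would be \<open>0\<close>.
\<close>

definition gtrsim :: "(nat \<Rightarrow> real) \<Rightarrow> (nat \<Rightarrow> real) \<Rightarrow> bool"  (infix \<open>\<greatersim>\<close> 50) where
  "g1 \<greatersim> g2 \<longleftrightarrow> (\<exists>C::real. C > 0 \<and> liminf (\<lambda>n. ereal (g1 n) / ereal (g2 n)) \<ge> ereal C)"


subsection \<open>Closed form of the average number of cycles\<close>

lemma cycle_edges_nth:
  assumes "length xs = k" "i < k"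
  shows "{xs ! i, xs ! (Suc i mod k)} \<in> cycle_edges xs"
  using assms by (auto simp: cycle_edges_def)

lemma cycle_edges_rotate_subset: "cycle_edges (rotate j xs) \<subseteq> cycle_edges xs"
proof
  fix e assume "e \<in> cycle_edges (rotate j xs)"
  then obtain i where i: "i < length xs"
    and e: "e = {rotate j xs ! i, rotate j xs ! (Suc i mod length xs)}"
    by (auto simp: cycle_edges_def)
  let ?k = "length xs"
  have "Suc i mod ?k < ?k" using i by (intro mod_less_divisor) linarith
  hence "e = {xs ! ((j + i) mod ?k), xs ! ((j + Suc i mod ?k) mod ?k)}"
    unfolding e using i by (simp add: nth_rotate)
  also have "(j + Suc i mod ?k) mod ?k = Suc ((j + i) mod ?k) mod ?k"
    by (metis add_Suc_right mod_Suc_eq mod_add_right_eq)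
  finally have "e = {xs ! ((j + i) mod ?k), xs ! (Suc ((j + i) mod ?k) mod ?k)}" .
  moreover have "(j + i) mod ?k < ?k" using i by (intro mod_less_divisor) linarith
  ultimately show "e \<in> cycle_edges xs"
    using cycle_edges_nth[of xs ?k "(j + i) mod ?k"] by simp
qed

lemma cycle_edges_rotate: "cycle_edges (rotate j xs) = cycle_edges xs"
proof
  show "cycle_edges xs \<subseteq> cycle_edges (rotate j xs)"
  proof (cases "xs = []")
    case False
    let ?k = "length xs"
    have "rotate (?k - j mod ?k) (rotate j xs) = rotate ((?k - j mod ?k + j) mod ?k) xs"
      by (metis rotate_conv_mod rotate_rotate)
    also have "(?k - j mod ?k + j) mod ?k = (?k - j mod ?k + j mod ?k) mod ?k"
      by (rule mod_add_right_eq[symmetric])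
    also have "\<dots> = 0"
      using False by (simp add: mod_le_divisor)
    finally have "rotate (?k - j mod ?k) (rotate j xs) = xs" by simp
    thus ?thesis by (metis cycle_edges_rotate_subset)
  qed simp
qed (rule cycle_edges_rotate_subset)

lemma cycle_edges_rev_subset: "cycle_edges (rev xs) \<subseteq> cycle_edges xs"
proof
  fix e assume "e \<in> cycle_edges (rev xs)"
  then obtain i where i: "i < length xs"
    and e: "e = {rev xs ! i, rev xs ! (Suc i mod length xs)}"
    by (auto simp: cycle_edges_def)
  let ?k = "length xs"
  show "e \<in> cycle_edges xs"
  proof (cases "Suc i = ?k")
    case True
    hence "e = {xs ! (?k - 1), xs ! (Suc (?k - 1) mod ?k)}"
      unfolding e using i True[symmetric] by (simp add: rev_nth insert_commute)
    thus ?thesis using i cycle_edges_nth[of xs ?k "?k - 1"] by simp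
  next
    case False
    hence s: "Suc i < ?k" using i by simp
    have eq: "Suc (?k - Suc (Suc i)) = ?k - Suc i" using s by simp
    have "e = {xs ! (?k - Suc (Suc i)), xs ! (Suc (?k - Suc (Suc i)) mod ?k)}"
      unfolding e eq using s i by (auto simp: rev_nth)
    thus ?thesis using s cycle_edges_nth[of xs ?k "?k - Suc (Suc i)"] by simp
  qed
qed

lemma cycle_edges_rev: "cycle_edges (rev xs) = cycle_edges xs"
  by (metis cycle_edges_rev_subset rev_rev_ident subset_antisym)

lemma cycle_edges_determine_list:
  assumes ys: "length ys = k" "distinct ys" and zs: "length zs = k" "distinct zs"
    and ce: "cycle_edges ys = cycle_edges zs" and k: "k \<ge> 3"
    and start: "ys ! 0 = zs ! 0" "ys ! 1 = zs ! 1"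
  shows "ys = zs"
proof -
  have "Suc i < k \<Longrightarrow> ys ! i = zs ! i \<and> ys ! Suc i = zs ! Suc i" for i
  proof (induction i)
    case 0
    thus ?case using start by simp
  next
    case (Suc i)
    hence IH: "ys ! i = zs ! i" "ys ! Suc i = zs ! Suc i" by auto
    have "{ys ! Suc i, ys ! Suc (Suc i)} \<in> cycle_edges ys"
      using cycle_edges_nth[of ys k "Suc i"] ys Suc.prems by simp
    then obtain j where j: "j < k"
      and eq: "{ys ! Suc i, ys ! Suc (Suc i)} = {zs ! j, zs ! (Suc j mod k)}"
      unfolding ce using zs by (auto simp: cycle_edges_def)
    from eq IH consider
        "zs ! Suc i = zs ! j" "ys ! Suc (Suc i) = zs ! (Suc j mod k)"
      | "zs ! Suc i = zs ! (Suc j mod k)" "ys ! Suc (Suc i) = zs ! j"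
      by (auto simp: doubleton_eq_iff)
    thus ?case
    proof cases
      case 1
      hence "j = Suc i" using zs j Suc.prems by (simp add: nth_eq_iff_index_eq)
      thus ?thesis using 1 IH Suc.prems by simp
    next
      case 2
      have "Suc j mod k < k" using k by simp
      hence "Suc j mod k = Suc i" using 2 zs Suc.prems by (metis Suc_lessD nth_eq_iff_index_eq)
      hence "j = i" using j by (cases "Suc j = k") auto
      hence "ys ! Suc (Suc i) = ys ! i" using 2 IH by simp
      thus ?thesis using ys Suc.prems by (simp add: nth_eq_iff_index_eq)
    qed
  qed
  hence step: "Suc i < k \<Longrightarrow> ys ! i = zs ! i \<and> ys ! Suc i = zs ! Suc i" for i .
  show ?thesis
  proof (rule nth_equalityI)
    fix i assume "i < length ys"
    thus "ys ! i = zs ! i"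
      using step[of i] step[of "i - 1"] ys k by (cases "Suc i < k"; cases i) auto
  qed (use ys zs in simp)
qed

lemma Suc_mod_inj:
  assumes "i < k" "j < k" "Suc i mod k = Suc j mod (k::nat)"
  shows "i = j"
  using assms by (cases "Suc i = k"; cases "Suc j = k") auto

lemma Suc_mod_antisym:
  assumes "i < k" "Suc (Suc i mod k) mod k = i" "k \<ge> (3::nat)"
  shows False
  using assms by (cases "Suc i = k"; cases "Suc (Suc i) = k") auto

lemma inj_on_cycle_edges_nth:
  assumes xs: "length xs = k" "distinct xs" and k: "k \<ge> 3"
  shows "inj_on (\<lambda>i. {xs ! i, xs ! (Suc i mod k)}) {..<k}"
proof (rule inj_onI)
  fix i j assume ij: "i \<in> {..<k}" "j \<in> {..<k}"
    and eq: "{xs ! i, xs ! (Suc i mod k)} = {xs ! j, xs ! (Suc j mod k)}"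
  have [simp]: "Suc i mod k < k" "Suc j mod k < k" using k by auto
  from eq have "i = j \<or> (i = Suc j mod k \<and> Suc i mod k = j)"
    using xs ij by (auto simp: doubleton_eq_iff nth_eq_iff_index_eq)
  thus "i = j" using Suc_mod_antisym[of j k] ij k by auto
qed

lemma card_lists_of_cycle:
  assumes xs: "length xs = k" "distinct xs" and k: "k \<ge> 3"
  shows "card {ys. length ys = k \<and> distinct ys \<and> cycle_edges ys = cycle_edges xs} = 2 * k"
    (is "card ?F = _")
proof -
  define A where "A = (\<lambda>i. (xs ! i, xs ! (Suc i mod k))) ` {..<k}"
  define B where "B = (\<lambda>i. (xs ! (Suc i mod k), xs ! i)) ` {..<k}"
  have [simp]: "Suc i mod k < k" for i using k by auto
  have cA: "card A = k" and cB: "card B = k"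
    unfolding A_def B_def using xs by (subst card_image; force simp: inj_on_def nth_eq_iff_index_eq)+
  have AB: "A \<inter> B = {}"
  proof (rule ccontr)
    assume "A \<inter> B \<noteq> {}"
    then obtain i j where "i < k" "j < k" "xs ! i = xs ! (Suc j mod k)" "xs ! (Suc i mod k) = xs ! j"
      by (auto simp: A_def B_def)
    hence "i = Suc j mod k" "Suc i mod k = j" using xs by (auto simp: nth_eq_iff_index_eq)
    thus False using Suc_mod_antisym[of j k] \<open>j < k\<close> k by auto
  qed
  have "bij_betw (\<lambda>ys. (ys ! 0, ys ! 1)) ?F (A \<union> B)"
    unfolding bij_betw_def
  proof (intro conjI subset_antisym subsetI)
    show "inj_on (\<lambda>ys. (ys ! 0, ys ! 1)) ?F"
      using cycle_edges_determine_list[OF _ _ _ _ _ k] by (auto intro!: inj_onI)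
  next
    fix p assume "p \<in> (\<lambda>ys. (ys ! 0, ys ! 1)) ` ?F"
    then obtain ys where ys: "length ys = k" "cycle_edges ys = cycle_edges xs"
      and p: "p = (ys ! 0, ys ! 1)" by auto
    have "{ys ! 0, ys ! 1} \<in> cycle_edges xs"
      using cycle_edges_nth[of ys k 0] ys k by simp
    then obtain i where "i < k" "{ys ! 0, ys ! 1} = {xs ! i, xs ! (Suc i mod k)}"
      using xs by (auto simp: cycle_edges_def)
    thus "p \<in> A \<union> B" unfolding p A_def B_def by (auto simp: doubleton_eq_iff)
  next
    fix p assume "p \<in> A \<union> B"
    then consider i where "i < k" "p = (xs ! i, xs ! (Suc i mod k))"
      | i where "i < k" "p = (xs ! (Suc i mod k), xs ! i)"
      by (auto simp: A_def B_def)
    thus "p \<in> (\<lambda>ys. (ys ! 0, ys ! 1)) ` ?F"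
    proof cases
      case 1
      have "p = (rotate i xs ! 0, rotate i xs ! 1)"
        using 1 xs k by (simp add: nth_rotate)
      thus ?thesis
        using xs by (intro image_eqI[where x = "rotate i xs"]) (auto simp: cycle_edges_rotate)
    next
      case 2
      define j where "j = (k - Suc (Suc i mod k)) mod k"
      have s: "Suc i mod k < k" by simp
      have "rotate j (rev xs) ! 0 = rev xs ! (k - Suc (Suc i mod k))"
        using xs k s by (subst nth_rotate) (auto simp: j_def)
      hence "rotate j (rev xs) ! 0 = xs ! (Suc i mod k)"
        using xs k Suc_diff_Suc[OF s] s by (simp add: rev_nth del: mod_less)
      moreover have "rotate j (rev xs) ! 1 = rev xs ! (Suc j mod k)"
        using xs k by (simp add: nth_rotate)
      moreover have "Suc j mod k = k - Suc i"
        using \<open>i < k\<close> k by (cases "Suc i = k") (auto simp: j_def)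
      moreover have "rev xs ! (k - Suc i) = xs ! i"
        using \<open>i < k\<close> xs by (simp add: rev_nth)
      ultimately have "p = (rotate j (rev xs) ! 0, rotate j (rev xs) ! 1)"
        using 2 by simp
      thus ?thesis
        using xs by (intro image_eqI[where x = "rotate j (rev xs)"])
          (auto simp: cycle_edges_rotate cycle_edges_rev)
    qed
  qed
  hence "card ?F = card (A \<union> B)" by (rule bij_betw_same_card)
  also have "\<dots> = 2 * k" using cA cB AB by (subst card_Un_disjoint) (auto simp: A_def B_def)
  finally show ?thesis .
qed

lemma Union_cycle_edges: "\<Union> (cycle_edges xs) = set xs"
proof
  show "\<Union> (cycle_edges xs) \<subseteq> set xs"
  proof (clarsimp simp: cycle_edges_def)
    fix x i assume "i < length xs" "x = xs ! i \<or> x = xs ! (Suc i mod length xs)"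
    moreover from this have "Suc i mod length xs < length xs" by (intro mod_less_divisor) linarith
    ultimately show "x \<in> set xs" by auto
  qed
  show "set xs \<subseteq> \<Union> (cycle_edges xs)"
    by (force simp: cycle_edges_def in_set_conv_nth)
qed

lemma finite_cycles [simp]: "finite (cycles n k)"
proof -
  have "finite {xs. length xs = k \<and> distinct xs \<and> set xs \<subseteq> {..<n}}"
    by (rule finite_subset[OF _ finite_lists_length_eq[of "{..<n}" k]]) auto
  thus ?thesis by (simp add: cycles_def)
qed

lemma card_cycles:
  assumes k: "k \<ge> 3"
  shows "real (card (cycles n k)) = fact k / (2 * real k) * real (n choose k)"
proof -
  define L where "L = {xs. length xs = k \<and> distinct xs \<and> set xs \<subseteq> {..<n}}"
  have fin: "finite L"
    unfolding L_def by (rule finite_subset[OF _ finite_lists_length_eq[of "{..<n}" k]]) auto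
  have "card L = (\<Sum>c\<in>cycles n k. card {xs \<in> L. cycle_edges xs = c})"
  proof -
    have "L = (\<Union>c\<in>cycles n k. {xs \<in> L. cycle_edges xs = c})"
      by (auto simp: cycles_def L_def)
    hence "card L = card (\<Union>c\<in>cycles n k. {xs \<in> L. cycle_edges xs = c})" by simp
    also have "\<dots> = (\<Sum>c\<in>cycles n k. card {xs \<in> L. cycle_edges xs = c})"
      using fin by (intro card_UN_disjoint) auto
    finally show ?thesis .
  qed
  also have "\<dots> = (\<Sum>c\<in>cycles n k. 2 * k)"
  proof (rule sum.cong)
    fix c assume "c \<in> cycles n k"
    then obtain xs where xs: "length xs = k" "distinct xs" "set xs \<subseteq> {..<n}" "c = cycle_edges xs"
      by (auto simp: cycles_def)
    have "{ys \<in> L. cycle_edges ys = c}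
        = {ys. length ys = k \<and> distinct ys \<and> cycle_edges ys = cycle_edges xs}"
      using xs Union_cycle_edges by (auto simp: L_def) (metis Union_cycle_edges lessThan_iff subset_eq)
    thus "card {ys \<in> L. cycle_edges ys = c} = 2 * k"
      using card_lists_of_cycle[OF xs(1,2) k] by simp
  qed simp
  finally have 1: "card L = 2 * k * card (cycles n k)" by simp
  have 2: "card L = fact k * (n choose k)"
  proof (cases "k \<le> n")
    case True
    have "card L = \<Prod>{n - k + 1..n}"
      unfolding L_def using card_lists_distinct_length_eq[of "{..<n}" k] True by simp
    also have "\<dots> = fact n div fact (n - k)"
      using fact_div_fact[of "n - k" n] by simp
    also have "\<dots> = fact k * (n choose k)"
      unfolding binomial_fact_lemma[OF True, symmetric] by (simp add: mult_ac)
    finally show ?thesis .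
  next
    case False
    have "L = {}"
    proof (rule ccontr)
      assume "L \<noteq> {}"
      then obtain xs where "length xs = k" "distinct xs" "set xs \<subseteq> {..<n}" by (auto simp: L_def)
      thus False using False card_mono[of "{..<n}" "set xs"] by (simp add: distinct_card)
    qed
    thus ?thesis using False by (simp add: binomial_eq_0)
  qed
  have "2 * real k * real (card (cycles n k)) = fact k * real (n choose k)"
    using arg_cong[OF 1[unfolded 2], of real] by simp
  thus ?thesis using k by (simp add: field_simps)
qed

lemma finite_vertex_pairs [simp]: "finite (vertex_pairs n)"
  by (rule finite_subset[of _ "Pow {..<n}"]) (auto simp: vertex_pairs_def)

lemma cycle_edges_subset_vertex_pairs:
  assumes xs: "length xs = k" "distinct xs" "set xs \<subseteq> {..<n}" and k: "k \<ge> 3"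
  shows "cycle_edges xs \<subseteq> vertex_pairs n"
proof
  fix e assume "e \<in> cycle_edges xs"
  then obtain i where i: "i < k" and e: "e = {xs ! i, xs ! (Suc i mod k)}"
    using xs by (auto simp: cycle_edges_def)
  have s: "Suc i mod k < k" using k by simp
  have "Suc i mod k \<noteq> i" using i k by (cases "Suc i = k") auto
  hence "xs ! i \<noteq> xs ! (Suc i mod k)" using xs i s by (simp add: nth_eq_iff_index_eq)
  moreover have "xs ! i \<in> {..<n}" "xs ! (Suc i mod k) \<in> {..<n}"
    using xs(1) i s by (metis nth_mem subsetD xs(3))+
  ultimately show "e \<in> vertex_pairs n"
    by (simp add: e vertex_pairs_def)
qed

lemma conn_prob_Min_Max:
  "conn_prob \<mu> n (w (Min {u, v})) (w (Max {u, v})) = conn_prob \<mu> n (w u) (w v)"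
  by (cases "u \<le> v") (auto simp: conn_prob_def min_def max_def mult.commute)

lemma pmf_bernoulli_clamp: "pmf (bernoulli_pmf p) True = min 1 (max 0 p)"
  by (simp add: bernoulli_pmf.rep_eq)

lemma prob_cycle_graph_pmf:
  assumes xs: "length xs = k" "distinct xs" "set xs \<subseteq> {..<n}" and k: "k \<ge> 3"
  shows "measure_pmf.prob (graph_pmf \<mu> n w) {G. cycle_edges xs \<subseteq> G}
       = (\<Prod>i<k. min 1 (max 0 (conn_prob \<mu> n (w (xs ! i)) (w (xs ! (Suc i mod k))))))"
proof -
  define p where "p = (\<lambda>e. conn_prob \<mu> n (w (Min e)) (w (Max e)))"
  define P where "P = Pi_pmf (vertex_pairs n) False (\<lambda>e. bernoulli_pmf (p e))"
  let ?c = "cycle_edges xs"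
  note sub = cycle_edges_subset_vertex_pairs[OF xs k]
  have "measure_pmf.prob (graph_pmf \<mu> n w) {G. ?c \<subseteq> G}
      = measure_pmf.prob P (Collect -` {G. ?c \<subseteq> G})"
    by (simp add: graph_pmf_def P_def p_def)
  also have "Collect -` {G. ?c \<subseteq> G} = Pi (vertex_pairs n) (\<lambda>e. if e \<in> ?c then {True} else UNIV)"
    using sub by (auto simp: Pi_def)
  also have "measure_pmf.prob P \<dots>
      = (\<Prod>e\<in>vertex_pairs n. measure_pmf.prob (bernoulli_pmf (p e)) (if e \<in> ?c then {True} else UNIV))"
    unfolding P_def by (rule measure_Pi_pmf_Pi) simp
  also have "\<dots> = (\<Prod>e\<in>vertex_pairs n. if e \<in> ?c then min 1 (max 0 (p e)) else 1)"
    by (intro prod.cong) (auto simp: measure_pmf_single pmf_bernoulli_clamp)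
  also have "\<dots> = (\<Prod>e\<in>?c. min 1 (max 0 (p e)))"
    using sub by (subst prod.inter_restrict[symmetric]) (auto simp: Int_absorb1)
  also have "\<dots> = (\<Prod>i<k. min 1 (max 0 (p {xs ! i, xs ! (Suc i mod k)})))"
    unfolding cycle_edges_def using xs inj_on_cycle_edges_nth[OF xs(1,2) k]
    by (simp add: prod.reindex)
  also have "\<dots> = (\<Prod>i<k. min 1 (max 0 (conn_prob \<mu> n (w (xs ! i)) (w (xs ! (Suc i mod k))))))"
    unfolding p_def conn_prob_Min_Max ..
  finally show ?thesis .
qed

lemma expectation_cycle_count:
  "measure_pmf.expectation (graph_pmf \<mu> n w) (\<lambda>G. real (cycle_count n k G))
     = (\<Sum>c\<in>cycles n k. measure_pmf.prob (graph_pmf \<mu> n w) {G. c \<subseteq> G})"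
proof -
  have "real (cycle_count n k G) = (\<Sum>c\<in>cycles n k. indicator {G. c \<subseteq> G} G)" for G
    unfolding cycle_count_def indicator_def
    by (simp add: sum.If_cases Int_def)
  hence "measure_pmf.expectation (graph_pmf \<mu> n w) (\<lambda>G. real (cycle_count n k G))
      = measure_pmf.expectation (graph_pmf \<mu> n w)
          (\<lambda>G. \<Sum>c\<in>cycles n k. indicator {G. c \<subseteq> G} G)"
    by presburger
  also have "\<dots> = (\<Sum>c\<in>cycles n k.
      measure_pmf.expectation (graph_pmf \<mu> n w) (indicator {G. c \<subseteq> G}))"
    by (rule Bochner_Integration.integral_sum)
       (auto intro!: measure_pmf.integrable_const_bound[where B = 1] simp: indicator_def)
  finally show ?thesis by simp
qed

text \<open>Exchangeability of i.i.d. variables.\<close>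

lemma (in prob_space) integral_iid_reindex:
  fixes H :: "nat \<Rightarrow> 'a \<Rightarrow> real" and f :: "(nat \<Rightarrow> real) \<Rightarrow> real"
  assumes ind: "indep_vars (\<lambda>_. borel) H UNIV"
    and law: "\<And>i. distr M borel (H i) = D"
    and s: "inj_on s {..<k}" and k: "k > 0"
    and f: "f \<in> borel_measurable (PiM {..<k} (\<lambda>_. borel))"
  shows "(LINT \<omega>|M. f (\<lambda>i\<in>{..<k}. H (s i) \<omega>)) = integral\<^sup>L (PiM {..<k} (\<lambda>_. D)) f"
proof -
  have rv: "random_variable borel (H i)" for i
    using ind by (auto simp: indep_vars_def)
  have "indep_vars (\<lambda>_. borel) (\<lambda>i. H (s i)) {..<k}"
    unfolding indep_vars_def2
  proof
    show "\<forall>i\<in>{..<k}. random_variable borel (H (s i))" using rv by simp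
    have I: "indep_sets (\<lambda>i. {H i -` A \<inter> space M |A. A \<in> sets borel}) (s ` {..<k})"
      using ind by (auto simp: indep_vars_def2 intro: indep_sets_mono_index[rotated])
    show "indep_sets (\<lambda>i. {H (s i) -` A \<inter> space M |A. A \<in> sets borel}) {..<k}"
    proof (rule indep_setsI)
      show "{H (s i) -` A \<inter> space M |A. A \<in> sets borel} \<subseteq> events" for i
        using rv by (auto intro: measurable_sets)
    next
      fix A J assume J: "J \<noteq> {}" "J \<subseteq> {..<k}" "finite J"
        and A: "\<forall>j\<in>J. A j \<in> {H (s j) -` A \<inter> space M |A. A \<in> sets borel}"
      have inj: "inj_on s J" using s J(2) by (rule inj_on_subset)
      define A' where "A' = (\<lambda>i. A (the_inv_into J s i))"
      have A': "A' (s j) = A j" if "j \<in> J" for j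
        using that inj by (simp add: A'_def the_inv_into_f_f)
      have "prob (\<Inter>i\<in>s ` J. A' i) = (\<Prod>i\<in>s ` J. prob (A' i))"
        by (rule indep_setsD[OF I]) (use J A A' in auto)
      thus "prob (\<Inter>j\<in>J. A j) = (\<Prod>j\<in>J. prob (A j))"
        using inj A' by (simp add: prod.reindex)
    qed
  qed
  hence eq: "distr M (PiM {..<k} (\<lambda>_. borel)) (\<lambda>\<omega>. \<lambda>i\<in>{..<k}. H (s i) \<omega>) = PiM {..<k} (\<lambda>_. D)"
    using k rv law by (subst (asm) indep_vars_iff_distr_eq_PiM') auto
  have "(\<lambda>\<omega>. \<lambda>i\<in>{..<k}. H (s i) \<omega>) \<in> measurable M (PiM {..<k} (\<lambda>_. borel))"
    using rv by (intro measurable_restrict) auto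
  from integral_distr[OF this f] eq show ?thesis by simp
qed

lemma avg_cycles_eq:
  fixes H :: "nat \<Rightarrow> 'a \<Rightarrow> real"
  assumes M: "prob_space M"
    and ind: "prob_space.indep_vars M (\<lambda>_. borel) H UNIV"
    and law: "\<And>i. distr M borel (H i) = D"
    and pos: "\<And>i. AE \<omega> in M. H i \<omega> \<ge> 0"
    and k: "k \<ge> 3"
  shows "avg_cycles M H k n = fact k / (2 * real k) * real (n choose k) * cycle_prob M H k n"
proof -
  interpret prob_space M by fact
  define \<mu> where "\<mu> = integral\<^sup>L M (H 0)"
  have \<mu>: "\<mu> \<ge> 0" unfolding \<mu>_def using pos by (intro integral_nonneg_AE)
  have rv: "random_variable borel (H i)" for i
    using ind by (auto simp: indep_vars_def)
  have pos': "AE \<omega> in M. \<forall>i. H i \<omega> \<ge> 0" using pos by (simp add: AE_all_countable)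
  define g where "g = (\<lambda>h h'. min 1 (max 0 (conn_prob \<mu> n h h')))"
  define q where "q = (\<lambda>xs \<omega>. \<Prod>i<k. g (H (xs ! i) \<omega>) (H (xs ! (Suc i mod k)) \<omega>))"
  define f where "f = (\<lambda>x. \<Prod>i<k. g (x i) (x (Suc i mod k)))"
  have sk: "Suc i mod k < k" for i using k by simp
  have f: "f \<in> borel_measurable (PiM {..<k} (\<lambda>_. borel))"
    unfolding f_def g_def conn_prob_def using sk
    by (intro borel_measurable_prod borel_measurable_min borel_measurable_max
        borel_measurable_const borel_measurable_divide borel_measurable_times
        measurable_component_singleton) auto
  have q_meas: "q xs \<in> borel_measurable M" for xs
    unfolding q_def g_def conn_prob_def using rv by measurable
  have q_int: "integrable M (q xs)" for xs
    by (rule integrable_const_bound[OF _ q_meas, where B = 1])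
       (auto simp: q_def g_def abs_prod intro!: prod_le_1)
  have q_val: "integral\<^sup>L M (q xs) = cycle_prob M H k n" if xs: "length xs = k" "distinct xs" for xs
  proof -
    have "(LINT \<omega>|M. f (\<lambda>i\<in>{..<k}. H (xs ! i) \<omega>)) = integral\<^sup>L (PiM {..<k} (\<lambda>_. D)) f"
      by (rule integral_iid_reindex[OF ind law _ _ f])
         (use xs k in \<open>auto simp: inj_on_def nth_eq_iff_index_eq\<close>)
    also have "\<dots> = (LINT \<omega>|M. f (\<lambda>i\<in>{..<k}. H i \<omega>))"
      by (rule integral_iid_reindex[OF ind law _ _ f, where s = "\<lambda>i. i", symmetric])
         (use k in auto)
    finally have "integral\<^sup>L M (q xs)
        = (LINT \<omega>|M. (\<Prod>i<k. g (H i \<omega>) (H (Suc i mod k) \<omega>)))"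
      using sk by (simp add: f_def q_def)
    also have "\<dots> = cycle_prob M H k n"
      unfolding cycle_prob_def \<mu>_def[symmetric]
    proof (rule integral_cong_AE)
      show "AE \<omega> in M. (\<Prod>i<k. g (H i \<omega>) (H (Suc i mod k) \<omega>))
          = (\<Prod>i<k. conn_prob \<mu> n (H i \<omega>) (H (Suc i mod k) \<omega>))"
        using pos'
      proof eventually_elim
        case (elim \<omega>)
        thus ?case using \<mu> by (intro prod.cong) (auto simp: g_def conn_prob_def)
      qed
    qed (use rv in \<open>unfold g_def conn_prob_def, measurable\<close>)
    finally show ?thesis .
  qed
  have cyc: "\<exists>xs. length xs = k \<and> distinct xs \<and> set xs \<subseteq> {..<n} \<and> c = cycle_edges xs"
    if "c \<in> cycles n k" for c using that by (auto simp: cycles_def)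
  then obtain r where r: "\<And>c. c \<in> cycles n k \<Longrightarrow> length (r c) = k \<and> distinct (r c)
      \<and> set (r c) \<subseteq> {..<n} \<and> c = cycle_edges (r c)" by metis
  have "avg_cycles M H k n = (LINT \<omega>|M. (\<Sum>c\<in>cycles n k.
      measure_pmf.prob (graph_pmf \<mu> n (\<lambda>i. H i \<omega>)) {G. c \<subseteq> G}))"
    by (simp add: avg_cycles_def expectation_cycle_count \<mu>_def)
  also have "\<dots> = (LINT \<omega>|M. (\<Sum>c\<in>cycles n k. q (r c) \<omega>))"
  proof (intro Bochner_Integration.integral_cong sum.cong refl)
    fix \<omega> c assume "c \<in> cycles n k"
    note rc = r[OF this]
    have "measure_pmf.prob (graph_pmf \<mu> n (\<lambda>i. H i \<omega>)) {G. cycle_edges (r c) \<subseteq> G} = q (r c) \<omega>"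
      unfolding q_def g_def by (rule prob_cycle_graph_pmf) (use rc k in auto)
    thus "measure_pmf.prob (graph_pmf \<mu> n (\<lambda>i. H i \<omega>)) {G. c \<subseteq> G} = q (r c) \<omega>"
      using rc by simp
  qed
  also have "\<dots> = (\<Sum>c\<in>cycles n k. integral\<^sup>L M (q (r c)))"
    by (rule Bochner_Integration.integral_sum) (rule q_int)
  also have "\<dots> = (\<Sum>c\<in>cycles n k. cycle_prob M H k n)"
    using q_val r by (intro sum.cong) auto
  also have "\<dots> = fact k / (2 * real k) * real (n choose k) * cycle_prob M H k n"
    by (simp add: card_cycles[OF k])
  finally show ?thesis .
qed

end

(*
  For 1 <= x <= sqrt N, where N = n mu, let all even-numbered vertices of the cycle have weight in
  [x, e x) and all odd-numbered ones weight in [N / x, e N / x). Then every edge joins weights with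
  product at least N, so it is present with probability 1, and the event has probability of order
  N^((1 - tau) k / 2) l(x)^(k/2) l(N / x)^(k/2). For x = e^j these events are disjoint, so their
  probabilities add up to a Riemann sum of the integral. Potter bounds make the comparison of sum
  and integral uniform, and they give the Karamata bound on the tail. Below a fixed level, where
  slow variation says nothing about l, either l^(k/2) is integrable and one term of the sum
  dominates that part of the integral, or the integral diverges and has the junk value 0.
*)
theory Submission
  imports Defs
begin

section \<open>Preliminaries: a criterion for the liminf bound, and uniform convergence of
  increments\<close>

text \<open>Strict positivity of \<open>g1 n\<close> covers the indices with
  \<open>g2 n = 0\<close>: there the extended real quotient is infinite rather than 0.\<close>

lemma gtrsimI:
  assumes "C > 0" "eventually (\<lambda>n. 0 < g1 n \<and> 0 \<le> g2 n \<and> C * g2 n \<le> g1 n) sequentially"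
  shows "g1 \<greatersim> g2"
  unfolding gtrsim_def
proof (intro exI[of _ C] conjI Liminf_bounded)
  show "eventually (\<lambda>n. ereal C \<le> ereal (g1 n) / ereal (g2 n)) sequentially"
    using assms(2)
  proof eventually_elim
    case (elim n)
    thus ?case by (cases "g2 n = 0") (auto simp: field_simps)
  qed
qed fact

(* G x, the integral of min 1 |f (x + s) - f x| over s in [0, 2], tends to 0 by dominated
   convergence. For u in [0, 1], integrating the triangle inequality through f (x + s) over
   s in [1, 2] bounds min 1 |f (x + u) - f x| by G x + G (x + u). *)
lemma additive_uniform_convergence:
  fixes f :: "real \<Rightarrow> real"
  assumes f [measurable]: "f \<in> borel_measurable borel"
    and lim: "\<And>u. ((\<lambda>x. f (x + u) - f x) \<longlongrightarrow> 0) at_top"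
    and \<delta>: "\<delta> > 0"
  shows "\<exists>a. \<forall>x\<ge>a. \<forall>u\<in>{0..1}. \<bar>f (x + u) - f x\<bar> \<le> \<delta>"
proof -
  define g where "g x s = indicator {0..2} s * min 1 \<bar>f (x + s) - f x\<bar>" for x s :: real
  define G where "G x = (LINT s|lborel. g x s)" for x
  have [measurable]: "g x \<in> borel_measurable borel" for x
    unfolding g_def by measurable
  have g_int: "integrable lborel (g x)" for x
    by (rule Bochner_Integration.integrable_bound[of lborel "indicator {0..2::real} :: _ \<Rightarrow> real"])
       (auto simp: g_def indicator_def)
  have "(G \<longlongrightarrow> integral\<^sup>L lborel (\<lambda>_ :: real. 0 :: real)) at_top"
    unfolding G_def
  proof (rule integral_dominated_convergence_at_top[where w = "indicator {0..2}"])
    show "AE s in lborel. ((\<lambda>x. g x s) \<longlongrightarrow> 0) at_top"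
    proof (rule AE_I2)
      fix s :: real
      have "((\<lambda>x. min 1 \<bar>f (x + s) - f x\<bar>) \<longlongrightarrow> min 1 \<bar>0\<bar>) at_top"
        by (intro tendsto_min tendsto_const tendsto_rabs lim)
      thus "((\<lambda>x. g x s) \<longlongrightarrow> 0) at_top"
        unfolding g_def by (auto intro: tendsto_mult_right_zero)
    qed
  qed (auto simp: g_def indicator_def)
  hence "(G \<longlongrightarrow> 0) at_top" by simp
  moreover have "min 1 \<delta> / 2 > 0" using \<delta> by simp
  ultimately have "eventually (\<lambda>x. G x < min 1 \<delta> / 2) at_top"
    by (rule order_tendstoD(2))
  then obtain a where a: "\<And>x. x \<ge> a \<Longrightarrow> G x < min 1 \<delta> / 2"
    by (auto simp: eventually_at_top_linorder)
  have "\<bar>f (x + u) - f x\<bar> \<le> \<delta>" if x: "x \<ge> a" and u: "u \<in> {0..1}" for x u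
  proof -
    let ?m = "min 1 \<bar>f (x + u) - f x\<bar>"
    \<comment> \<open>The shift makes both summands compare with \<open>f\<close> at the common
      point \<open>x + s\<close>. Since \<open>u\<close> is at most 1, \<open>s - u\<close> stays in
      [0, 2] for \<open>s\<close> in [1, 2].\<close>
    let ?h = "\<lambda>s. g (x + u) (- u + 1 * s)"
    have h_int: "integrable lborel ?h"
      by (rule lborel_integrable_real_affine[OF g_int]) simp
    have "?m = (LINT s|lborel. indicator {1..2::real} s * ?m)"
      by simp
    also have "\<dots> \<le> (LINT s|lborel. g x s + ?h s)"
    proof (rule integral_mono)
      show "integrable lborel (\<lambda>s. g x s + ?h s)"
        by (intro Bochner_Integration.integrable_add g_int h_int)
      show "indicator {1..2} s * ?m \<le> g x s + ?h s" for s
        using u by (auto simp: g_def indicator_def)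
    qed (auto intro!: integrable_real_mult_indicator)
    also have "\<dots> = (LINT s|lborel. g x s) + (LINT s|lborel. ?h s)"
      by (intro Bochner_Integration.integral_add g_int h_int)
    also have "(LINT s|lborel. ?h s) = G (x + u)"
      unfolding G_def using lborel_integral_real_affine[of 1 "g (x + u)" "- u"] by simp
    also have "(LINT s|lborel. g x s) = G x" by (simp add: G_def)
    \<comment> \<open>The bound is also below 1, so the truncation is inactive and the difference
      itself is controlled.\<close>
    also have "G x + G (x + u) < min 1 \<delta>"
      using a[of x] a[of "x + u"] x u by auto
    finally show ?thesis by (auto simp: min_def split: if_splits)
  qed
  thus ?thesis by blast
qed

section \<open>Potter bounds for slowly varying functions\<close>

text \<open>One \<open>\<delta>\<close> gives both the exponent and the constant
  \<open>exp \<delta>\<close>: on the logarithmic scale, passing from \<open>x\<close> to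
  \<open>y\<close> takes at most \<open>ln (y / x) + 1\<close> unit steps, each changing
  \<open>ln l\<close> by at most \<open>\<delta>\<close>.\<close>

definition potter_bounds :: "(real \<Rightarrow> real) \<Rightarrow> real \<Rightarrow> real \<Rightarrow> bool" where
  "potter_bounds l \<delta> x0 \<longleftrightarrow> (\<forall>x y. x0 \<le> x \<longrightarrow> x \<le> y \<longrightarrow> 0 < l x \<and>
     l y \<le> exp \<delta> * (y / x) powr \<delta> * l x \<and> l x \<le> exp \<delta> * (y / x) powr \<delta> * l y)"

text \<open>The ratio for \<open>c = 1\<close> is 0 wherever \<open>l\<close> vanishes, because 0 /
  0 = 0, so convergence to 1 excludes zeros far out.\<close>

lemma slowly_varying_eventually_pos:
  assumes l: "slowly_varying l" and nonneg: "\<And>h. l h \<ge> 0"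
  shows "eventually (\<lambda>h. l h > 0) at_top"
proof -
  have "((\<lambda>h. l (1 * h) / l h) \<longlongrightarrow> 1) at_top"
    using l unfolding slowly_varying_def by (metis zero_less_one)
  hence "eventually (\<lambda>h. l (1 * h) / l h > 0) at_top"
    by (rule order_tendstoD) simp
  thus ?thesis
  proof eventually_elim
    case (elim h)
    thus ?case using nonneg[of h] by (cases "l h = 0") auto
  qed
qed

text \<open>With \<open>f = ln o l o exp\<close>, slow variation says that increments of
  \<open>f\<close> tend to 0. Uniformity over unit increments can be chained over long intervals.
  The threshold is an integer power of e so that it matches the scales \<open>exp (real j)\<close>
  at which \<open>l\<close> is later sampled.\<close>

lemma slowly_varying_potter_bounds:
  assumes l: "slowly_varying l" and nonneg: "\<And>h. l h \<ge> 0"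
    and meas [measurable]: "l \<in> borel_measurable borel" and \<delta>: "\<delta> > 0"
  shows "\<exists>a::nat. potter_bounds l \<delta> (exp (real a))"
proof -
  define f where "f = (\<lambda>x. ln (l (exp x)))"
  obtain b where b: "\<And>h. h \<ge> b \<Longrightarrow> l h > 0"
    using slowly_varying_eventually_pos[OF l nonneg] by (auto simp: eventually_at_top_linorder)
  have "((\<lambda>x. f (x + u) - f x) \<longlongrightarrow> 0) at_top" for u
  proof -
    have "((\<lambda>h. l (exp u * h) / l h) \<longlongrightarrow> 1) at_top"
      using l unfolding slowly_varying_def by simp
    hence "((\<lambda>x. l (exp u * exp x) / l (exp x)) \<longlongrightarrow> 1) at_top"
      by (rule filterlim_compose[OF _ exp_at_top])
    hence "((\<lambda>x. ln (l (exp u * exp x) / l (exp x))) \<longlongrightarrow> ln 1) at_top"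
      by (rule tendsto_ln) simp
    moreover have "eventually (\<lambda>x. ln (l (exp u * exp x) / l (exp x)) = f (x + u) - f x) at_top"
    proof -
      have "eventually (\<lambda>x. exp x \<ge> b) at_top"
        using exp_at_top by (auto simp: filterlim_at_top)
      moreover have "filterlim (\<lambda>x. exp (x + u)) at_top at_top"
        by (rule filterlim_compose[OF exp_at_top])
           (simp add: add.commute[of _ u] filterlim_tendsto_add_at_top[OF tendsto_const filterlim_ident])
      hence "eventually (\<lambda>x. exp (x + u) \<ge> b) at_top" by (auto simp: filterlim_at_top)
      ultimately show ?thesis
      proof eventually_elim
        case (elim x)
        thus ?case using b[of "exp x"] b[of "exp (x + u)"]
          by (simp add: f_def ln_div exp_add mult.commute)
      qed
    qed
    ultimately show ?thesis by (simp add: tendsto_cong)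
  qed
  moreover have "f \<in> borel_measurable borel" unfolding f_def by measurable
  ultimately obtain c where c: "\<And>x u. x \<ge> c \<Longrightarrow> u \<in> {0..1} \<Longrightarrow> \<bar>f (x + u) - f x\<bar> \<le> \<delta>"
    using additive_uniform_convergence[of f \<delta>] \<delta> by blast
  have steps: "\<bar>f y - f x\<bar> \<le> \<delta> * real n" if "c \<le> x" "x \<le> y" "y \<le> x + real n" for x y n
    using that
  proof (induction n arbitrary: y)
    case (Suc n)
    show ?case
    proof (cases "y \<le> x + real n")
      case True
      thus ?thesis using Suc.IH[of y] Suc.prems \<delta> by (auto simp: algebra_simps)
    next
      case False
      have "\<bar>f (x + real n) - f x\<bar> \<le> \<delta> * real n" using Suc.IH Suc.prems by simp
      moreover have "\<bar>f (x + real n + (y - (x + real n))) - f (x + real n)\<bar> \<le> \<delta>"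
        using Suc.prems False by (intro c) auto
      ultimately show ?thesis by (simp add: algebra_simps)
    qed
  qed simp
  \<comment> \<open>\<open>a\<close> lies beyond the uniformity threshold \<open>c\<close>, and
    \<open>exp a \<ge> 1 + a\<close> puts \<open>exp a\<close> beyond the positivity threshold
    \<open>b\<close>.\<close>
  obtain a :: nat where a: "real a \<ge> max c (max b 0)" using real_arch_simple by blast
  have ab: "exp (real a) \<ge> b" using a exp_ge_add_one_self[of "real a"] by linarith
  have "0 < l x \<and> l y \<le> exp \<delta> * (y / x) powr \<delta> * l x \<and> l x \<le> exp \<delta> * (y / x) powr \<delta> * l y"
    if x: "exp (real a) \<le> x" and y: "x \<le> y" for x y
  proof -
    have pos: "x > 0" "y > 0" "l x > 0" "l y > 0"
      using x y b[of x] b[of y] ab exp_gt_zero[of "real a"] by linarith+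
    \<comment> \<open>Rounding up costs at most one extra step; this is the source of the factor
      \<open>exp \<delta>\<close>.\<close>
    define n where "n = nat \<lceil>ln y - ln x\<rceil>"
    have xy: "ln x \<le> ln y" using pos y by simp
    have n: "ln y - ln x \<le> real n" "real n \<le> ln y - ln x + 1"
      unfolding n_def using xy by linarith+
    have "ln x \<ge> real a" using x pos by (simp add: ln_ge_iff)
    hence "\<bar>f (ln y) - f (ln x)\<bar> \<le> \<delta> * real n"
      using a xy n by (intro steps) auto
    also have "\<dots> \<le> \<delta> * (ln y - ln x + 1)" using n \<delta> by (intro mult_left_mono) auto
    finally have *: "\<bar>ln (l y) - ln (l x)\<bar> \<le> \<delta> * (ln y - ln x) + \<delta>"
      using pos by (simp add: f_def algebra_simps)
    have eq: "exp \<delta> * (y / x) powr \<delta> = exp (\<delta> * (ln y - ln x) + \<delta>)"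
      using pos by (simp add: powr_def ln_div exp_add mult.commute)
    have **: "v \<le> exp K * w" if "ln v - ln w \<le> K" "v > 0" "w > 0" for v w K :: real
    proof -
      have "v = exp (ln v)" using that by simp
      also have "\<dots> \<le> exp (K + ln w)" using that(1) by (subst exp_le_cancel_iff) linarith
      also have "\<dots> = exp K * w" using that by (simp add: exp_add)
      finally show ?thesis .
    qed
    show ?thesis unfolding eq using * pos by (auto intro!: **)
  qed
  thus ?thesis unfolding potter_bounds_def by blast
qed

text \<open>The form for arguments within a bounded factor: \<open>(y / x) powr \<delta>\<close> is
  at most \<open>exp (b * \<delta>)\<close>, so the two values of \<open>l\<close> agree up to a
  constant.\<close>

lemma potter_bounds_near:
  assumes P: "potter_bounds l \<delta> x0" and x: "0 < x0" "x0 \<le> x" "x \<le> y" "y \<le> exp b * x"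
    and \<delta>: "\<delta> > 0"
  shows "0 < l x" "0 < l y" "l y \<le> exp (\<delta> + b * \<delta>) * l x" "l x \<le> exp (\<delta> + b * \<delta>) * l y"
proof -
  show pos: "0 < l x" "0 < l y"
    using P x unfolding potter_bounds_def by (meson order.refl order.trans)+
  have "(y / x) powr \<delta> \<le> exp b powr \<delta>"
    using x \<delta> by (intro powr_mono2) (auto simp: field_simps)
  hence "exp \<delta> * (y / x) powr \<delta> \<le> exp (\<delta> + b * \<delta>)"
    by (simp add: exp_add exp_powr_real)
  hence *: "exp \<delta> * (y / x) powr \<delta> * v \<le> exp (\<delta> + b * \<delta>) * v" if "v > 0" for v
    using that by (intro mult_right_mono) auto
  show "l y \<le> exp (\<delta> + b * \<delta>) * l x" "l x \<le> exp (\<delta> + b * \<delta>) * l y"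
    using P x *[OF pos(1)] *[OF pos(2)] unfolding potter_bounds_def by (meson order.trans)+
qed

section \<open>Integral estimates: a power tail, and the target integral against a sum over
  scales\<close>

lemma nn_integral_powr_atLeast:
  assumes "p > 1" "x > 0"
  shows "(\<integral>\<^sup>+h. ennreal (h powr - p) * indicator {x..} h \<partial>lborel) = ennreal (x powr (1 - p) / (p - 1))"
proof -
  have "((\<lambda>h. h powr - p) has_integral - (x powr (- p + 1)) / (- p + 1)) {x..}"
    using assms by (intro has_integral_powr_to_inf) auto
  moreover have "- (x powr (- p + 1)) / (- p + 1) = x powr (1 - p) / (p - 1)"
    using assms by (simp add: divide_simps) (simp add: algebra_simps)
  ultimately have "((\<lambda>h. if h \<in> {x..} then h powr - p else 0) has_integral x powr (1 - p) / (p - 1)) UNIV"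
    by (simp only: has_integral_restrict_UNIV)
  from nn_integral_has_integral_lborel[OF _ _ this]
  have "(\<integral>\<^sup>+h. ennreal (if h \<in> {x..} then h powr - p else 0) \<partial>lborel) = ennreal (x powr (1 - p) / (p - 1))"
    by auto
  moreover have "ennreal (if h \<in> {x..} then h powr - p else 0) = ennreal (h powr - p) * indicator {x..} h" for h
    by auto
  ultimately show ?thesis by simp
qed

text \<open>The substitution \<open>h = N * t\<close> turns the arguments of \<open>l\<close> into
  \<open>N * t\<close> and \<open>1 / t\<close>. The first is always beyond the Potter threshold.
  The second is so only for \<open>t \<le> exp (- a)\<close>, and there the intervals between
  consecutive powers of e are compared with the terms of the sum.\<close>

lemma alternating_integral_upper_bound:
  fixes l :: "real \<Rightarrow> real" and a m :: nat
  assumes P: "potter_bounds l \<delta> (exp (real a))" and \<delta>: "\<delta> > 0"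
    and nonneg: "\<And>h. l h \<ge> 0" and meas [measurable]: "l \<in> borel_measurable borel"
  shows "\<exists>C>0. \<forall>N. exp (real a + 1) \<le> sqrt N \<longrightarrow>
    (LINT h:{sqrt N..N}|lborel. 1 / h * (l h ^ m * l (N / h) ^ m))
      \<le> C * (\<Sum>j=a..nat \<lfloor>ln N / 2\<rfloor>. l (exp (real j)) ^ m * l (N / exp (real j)) ^ m)"
proof -
  define E where "E = exp (\<delta> + real a * \<delta>)"
  define E1 where "E1 = exp (\<delta> + 1 * \<delta>)"
  have E: "E > 0" "E1 > 0" by (auto simp: E_def E1_def)
  \<comment> \<open>The contribution of \<open>1 / t\<close> in [1, exp a], where the Potter bounds
    are silent. It does not involve \<open>N\<close>, so its finiteness is decided for all
    \<open>N\<close> at once.\<close>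
  define R where "R = (\<integral>\<^sup>+t. ennreal (1 / t * l (1 / t) ^ m) * indicator {exp (- real a)..1} t \<partial>lborel)"
  define g where "g N t = 1 / t * (l (N * t) ^ m * l (1 / t) ^ m)" for N t
  define I where "I N = (\<integral>\<^sup>+t. ennreal (g N t) * indicator {1 / sqrt N..1} t \<partial>lborel)" for N
  have [measurable]: "g N \<in> borel_measurable borel" for N
    unfolding g_def by measurable
  have lint: "(LINT h:{sqrt N..N}|lborel. 1 / h * (l h ^ m * l (N / h) ^ m)) = enn2real (I N)"
    if N: "exp (real a + 1) \<le> sqrt N" for N
  proof -
    have N0: "N > 0" using less_le_trans[OF exp_gt_zero N] by simp
    have "(LINT h:{sqrt N..N}|lborel. 1 / h * (l h ^ m * l (N / h) ^ m))
        = enn2real (\<integral>\<^sup>+h. ennreal (indicator {sqrt N..N} h * (1 / h * (l h ^ m * l (N / h) ^ m))) \<partial>lborel)"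
      unfolding set_lebesgue_integral_def real_scaleR_def
    proof (intro integral_eq_nn_integral AE_I2)
      fix h :: real
      show "0 \<le> indicator {sqrt N..N} h * (1 / h * (l h ^ m * l (N / h) ^ m))"
      proof (cases "h \<in> {sqrt N..N}")
        case True
        hence "h > 0" using N0 less_le_trans[of 0 "sqrt N" h] by simp
        thus ?thesis using nonneg by simp
      qed simp
    qed measurable
    also have "(\<integral>\<^sup>+h. ennreal (indicator {sqrt N..N} h * (1 / h * (l h ^ m * l (N / h) ^ m))) \<partial>lborel)
       = N * (\<integral>\<^sup>+t. ennreal (indicator {sqrt N..N} (0 + N * t)
            * (1 / (0 + N * t) * (l (0 + N * t) ^ m * l (N / (0 + N * t)) ^ m))) \<partial>lborel)"
      using N0 by (subst nn_integral_real_affine[where c = N and t = 0]) auto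
    also have "\<dots> = (\<integral>\<^sup>+t. ennreal N * ennreal (indicator {sqrt N..N} (0 + N * t)
            * (1 / (0 + N * t) * (l (0 + N * t) ^ m * l (N / (0 + N * t)) ^ m))) \<partial>lborel)"
      by (subst nn_integral_cmult) auto
    also have "\<dots> = I N"
      unfolding I_def
    proof (intro nn_integral_cong)
      fix t :: real
      have ind: "indicator {sqrt N..N} (0 + N * t) = (indicator {1 / sqrt N..1} t :: real)"
      proof -
        have "sqrt N \<le> N * t \<longleftrightarrow> sqrt N * 1 \<le> sqrt N * (sqrt N * t)"
          using N0 by (simp add: mult.assoc[symmetric])
        also have "\<dots> \<longleftrightarrow> 1 \<le> sqrt N * t"
          using N0 by (intro mult_le_cancel_left_pos) simp
        also have "\<dots> \<longleftrightarrow> 1 / sqrt N \<le> t"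
          using N0 by (simp add: divide_le_eq mult.commute)
        finally have "sqrt N \<le> N * t \<longleftrightarrow> 1 / sqrt N \<le> t" .
        moreover have "N * t \<le> N \<longleftrightarrow> t \<le> 1" using N0 by simp
        ultimately show ?thesis by (auto simp: indicator_def)
      qed
      show "ennreal N * ennreal (indicator {sqrt N..N} (0 + N * t)
            * (1 / (0 + N * t) * (l (0 + N * t) ^ m * l (N / (0 + N * t)) ^ m)))
          = ennreal (g N t) * indicator {1 / sqrt N..1} t"
        unfolding ind using N0
        by (auto simp: g_def indicator_def ennreal_mult'[symmetric])
    qed
    finally show ?thesis .
  qed
  \<comment> \<open>For these \<open>t\<close>, \<open>N * t\<close> is within a factor
    \<open>exp a\<close> of the reference point \<open>N / exp a\<close>, which is at least
    \<open>exp a\<close> because \<open>sqrt N\<close> is.\<close>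
  have low: "l (N / exp (real a)) > 0" "l (N * t) \<le> E * l (N / exp (real a))"
      "l (N / exp (real a)) \<le> E * l (N * t)"
    if N: "exp (real a + 1) \<le> sqrt N" and t: "t \<in> {exp (- real a)..1}" for N t
  proof -
    have N0: "N > 0" using less_le_trans[OF exp_gt_zero N] by simp
    have "exp (real a) * exp (real a) \<le> exp (real a + 1) * exp (real a + 1)"
      by (intro mult_mono) auto
    also have "\<dots> \<le> sqrt N * sqrt N" using N N0 by (intro mult_mono) auto
    finally have "exp (real a) \<le> N / exp (real a)" using N0 by (simp add: field_simps)
    moreover have "N / exp (real a) \<le> N * t" "N * t \<le> exp (real a) * (N / exp (real a))"
      using t N0 by (auto simp: exp_minus field_simps)
    ultimately show "l (N / exp (real a)) > 0" "l (N * t) \<le> E * l (N / exp (real a))"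
      "l (N / exp (real a)) \<le> E * l (N * t)"
      using potter_bounds_near[OF P exp_gt_zero, of "N / exp (real a)" "N * t" "real a"] \<delta>
      unfolding E_def by auto
  qed
  have small: "1 / sqrt N \<le> exp (- real a)" if N: "exp (real a + 1) \<le> sqrt N" for N
  proof -
    have "exp (real a) \<le> sqrt N" by (rule order.trans[OF _ N]) simp
    moreover have "sqrt N > 0" by (rule less_le_trans[OF exp_gt_zero N])
    ultimately show ?thesis by (simp add: exp_minus field_simps)
  qed
  show ?thesis
  proof (cases "R = \<infinity>")
    case True
    \<comment> \<open>\<open>I N\<close> dominates a positive multiple of \<open>R\<close>. The left
      side is therefore the default value 0, and any positive constant serves.\<close>
    have "I N = \<infinity>" if N: "exp (real a + 1) \<le> sqrt N" for N
    proof -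
      let ?c = "(l (N / exp (real a)) / E) ^ m"
      have c: "?c > 0" using low(1)[OF N, of 1] E by simp
      have "ennreal ?c * R = (\<integral>\<^sup>+t. ennreal ?c * (ennreal (1 / t * l (1 / t) ^ m)
          * indicator {exp (- real a)..1} t) \<partial>lborel)"
        unfolding R_def by (subst nn_integral_cmult) auto
      also have "\<dots> \<le> I N"
        unfolding I_def
      proof (intro nn_integral_mono)
        fix t :: real
        show "ennreal ?c * (ennreal (1 / t * l (1 / t) ^ m) * indicator {exp (- real a)..1} t)
          \<le> ennreal (g N t) * indicator {1 / sqrt N..1} t"
        proof (cases "t \<in> {exp (- real a)..1}")
          case True
          have t0: "t > 0" using True less_le_trans[OF exp_gt_zero, of "- real a" t] by simp
          have "?c \<le> l (N * t) ^ m"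
            using low(3)[OF N True] low(1)[OF N True] E by (intro power_mono) (auto simp: field_simps)
          hence "?c * (1 / t * l (1 / t) ^ m) \<le> l (N * t) ^ m * (1 / t * l (1 / t) ^ m)"
            using t0 nonneg by (intro mult_right_mono) auto
          also have "\<dots> = g N t" by (simp add: g_def)
          finally have "ennreal (?c * (1 / t * l (1 / t) ^ m)) \<le> ennreal (g N t)"
            by (rule ennreal_leI)
          moreover have "ennreal ?c * ennreal (1 / t * l (1 / t) ^ m) = ennreal (?c * (1 / t * l (1 / t) ^ m))"
            using c by (subst ennreal_mult') auto
          ultimately show ?thesis using True order.trans[OF small[OF N], of t] by simp
        qed simp
      qed
      finally have "ennreal ?c * R \<le> I N" .
      moreover have "ennreal ?c \<noteq> 0" using c by (simp only: ennreal_eq_0_iff not_le)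
      hence "ennreal ?c * R = \<infinity>"
        using True unfolding infinity_ennreal_def ennreal_mult_eq_top_iff by blast
      ultimately show ?thesis by (simp only: infinity_ennreal_def top_unique)
    qed
    thus ?thesis
      using lint nonneg by (intro exI[of _ 1]) (auto intro!: sum_nonneg)
  next
    case False
    define r where "r = enn2real R"
    have r: "R = ennreal r" "r \<ge> 0" using False by (auto simp: r_def less_top)
    have la: "l (exp (real a)) > 0" using P unfolding potter_bounds_def by blast
    \<comment> \<open>The first summand expresses the part with \<open>t \<ge> exp (- a)\<close> as
      a multiple of the term \<open>j = a\<close>. In the second, \<open>E1 ^ (2 * m)\<close> is the
      Potter loss of both factors on a unit logarithmic interval, and \<open>exp 1\<close> is the
      loss in replacing \<open>1 / t\<close> by its maximum there.\<close>
    define C where "C = E ^ m * r / l (exp (real a)) ^ m + exp 1 * E1 ^ (2 * m)"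
    have "C > 0" unfolding C_def using r E la by (intro add_nonneg_pos) auto
    moreover have "enn2real (I N) \<le> C * (\<Sum>j=a..nat \<lfloor>ln N / 2\<rfloor>. l (exp (real j)) ^ m * l (N / exp (real j)) ^ m)"
      if N: "exp (real a + 1) \<le> sqrt N" for N
    proof -
      have N0: "N > 0" using less_le_trans[OF exp_gt_zero N] by simp
      define J where "J = {a..nat \<lfloor>ln N / 2\<rfloor>}"
      define s where "s j = l (exp (real j)) ^ m * l (N / exp (real j)) ^ m" for j :: nat
      have s: "s j \<ge> 0" for j unfolding s_def using nonneg by simp
      have sqrtN: "sqrt N = exp (ln N / 2)" using N0 exp_ln[of "sqrt N"] by (simp add: ln_sqrt)
      have aJ: "a \<in> J"
      proof -
        have "real a + 1 \<le> ln N / 2" using N unfolding sqrtN by simp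
        thus ?thesis unfolding J_def by (simp add: le_nat_iff le_floor_iff)
      qed
      let ?D = "\<lambda>j. E1 ^ (2 * m) * s j * exp (real j + 1)"
      let ?K = "E ^ m * l (N / exp (real a)) ^ m"
      have pt: "ennreal (g N t) * indicator {1 / sqrt N..1} t
          \<le> ennreal ?K * (ennreal (1 / t * l (1 / t) ^ m) * indicator {exp (- real a)..1} t)
            + (\<Sum>j\<in>J. ennreal (?D j) * indicator {exp (- (real j + 1))..exp (- real j)} t)" for t
      proof (cases "t \<in> {1 / sqrt N..1}")
        case t: True
        have t0: "t > 0" using t less_le_trans[of 0 "1 / sqrt N" t] N0 by simp
        show ?thesis
        proof (cases "exp (- real a) \<le> t")
          case True
          hence t': "t \<in> {exp (- real a)..1}" using t by simp
          have "g N t = l (N * t) ^ m * (1 / t * l (1 / t) ^ m)" by (simp add: g_def)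
          also have "\<dots> \<le> (E * l (N / exp (real a))) ^ m * (1 / t * l (1 / t) ^ m)"
            using low(2)[OF N t'] t0 nonneg by (intro mult_right_mono power_mono) auto
          finally have "ennreal (g N t) \<le> ennreal (?K * (1 / t * l (1 / t) ^ m))"
            by (intro ennreal_leI) (simp add: power_mult_distrib)
          also have "\<dots> = ennreal ?K * ennreal (1 / t * l (1 / t) ^ m)"
            using nonneg E by (subst ennreal_mult') auto
          finally show ?thesis using t' t by (simp add: add_increasing2)
        next
          case False
          \<comment> \<open>The logarithmic scale containing \<open>1 / t\<close>:
            \<open>t < exp (- a)\<close> gives \<open>j \<ge> a\<close>, and
            \<open>t \<ge> 1 / sqrt N\<close> gives \<open>exp j \<le> sqrt N\<close>.\<close>
          define j where "j = nat \<lfloor>- ln t\<rfloor>"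
          have "exp (ln t) < exp (- real a)" using False t0 by simp
          hence lnt: "ln t < - real a" by (simp only: exp_less_cancel_iff)
          have lnt2: "- ln t \<le> ln N / 2"
          proof -
            have "ln (1 / sqrt N) \<le> ln t" using t t0 N0 by (subst ln_le_cancel_iff) auto
            thus ?thesis using N0 by (simp add: ln_div ln_sqrt)
          qed
          have j: "real j \<le> - ln t" "- ln t < real j + 1" "a \<le> j"
            unfolding j_def using lnt by (linarith, linarith, simp add: le_nat_iff le_floor_iff)
          have jJ: "j \<in> J"
            using j(3) lnt2 unfolding J_def j_def by (auto intro!: nat_mono floor_mono)
          have "exp (- (real j + 1)) \<le> exp (ln t)" "exp (ln t) \<le> exp (- real j)"
            using j by (simp_all only: exp_le_cancel_iff)
          hence tj: "exp (- (real j + 1)) \<le> t" "t \<le> exp (- real j)"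
            using t0 by simp_all
          have "1 / t \<le> 1 / exp (- (real j + 1))"
            using tj(1) t0 by (intro divide_left_mono) auto
          also have "\<dots> = exp (real j + 1)"
            by (simp only: exp_minus inverse_eq_divide) simp
          finally have i1: "exp (real j) \<le> 1 / t" "1 / t \<le> exp (real j + 1)"
            using tj(2) t0 by (auto simp: exp_minus field_simps)
          have i2: "1 / t \<le> exp 1 * exp (real j)" using i1(2) by (simp add: exp_add mult.commute)
          have u1: "l (1 / t) \<le> E1 * l (exp (real j))"
            unfolding E1_def using potter_bounds_near(3)[OF P exp_gt_zero _ i1(1) i2 \<delta>] j(3) by simp
          \<comment> \<open>Here \<open>sqrt N * t \<ge> 1\<close>, so \<open>N * t\<close> is at
            least \<open>sqrt N\<close> and lies beyond the threshold too.\<close>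
          have "exp (real a + 1) * 1 \<le> sqrt N * (sqrt N * t)"
            using N t N0 by (intro mult_mono) (auto simp: field_simps)
          hence Nt1: "exp (real a + 1) \<le> N * t" using N0 by (simp add: mult.assoc[symmetric])
          have Nt0: "exp (real a) \<le> N * t" by (rule order.trans[OF _ Nt1]) simp
          have Nt2: "N * t \<le> N / exp (real j)"
            using tj(2) N0 by (simp add: exp_minus field_simps)
          have Nt3: "N / exp (real j) \<le> exp 1 * (N * t)"
            using mult_left_mono[OF i2, of "N * t * exp (- real j)"] t0 N0
            by (simp add: exp_minus field_simps)
          have u2: "l (N * t) \<le> E1 * l (N / exp (real j))"
            unfolding E1_def using potter_bounds_near(4)[OF P exp_gt_zero Nt0 Nt2 Nt3 \<delta>] by simp
          have "g N t \<le> exp (real j + 1) * ((E1 * l (N / exp (real j))) ^ m * (E1 * l (exp (real j))) ^ m)"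
            unfolding g_def using i1 u1 u2 nonneg t0 E by (intro mult_mono power_mono) auto
          also have "\<dots> = ?D j"
            by (simp add: s_def power_mult_distrib mult_2 power_add)
          finally have "ennreal (g N t) \<le> ennreal (?D j) * indicator {exp (- (real j + 1))..exp (- real j)} t"
            using tj by (simp add: ennreal_leI)
          also have "\<dots> \<le> (\<Sum>j\<in>J. ennreal (?D j) * indicator {exp (- (real j + 1))..exp (- real j)} t)"
            using jJ by (intro member_le_sum[of j J "\<lambda>j. ennreal (?D j) * indicator {exp (- (real j + 1))..exp (- real j)} t"])
              (auto simp: J_def)
          finally show ?thesis using t by (simp add: add_increasing)
        qed
      qed simp
      have "I N \<le> (\<integral>\<^sup>+t. ennreal ?K * (ennreal (1 / t * l (1 / t) ^ m) * indicator {exp (- real a)..1} t)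
            + (\<Sum>j\<in>J. ennreal (?D j) * indicator {exp (- (real j + 1))..exp (- real j)} t) \<partial>lborel)"
        unfolding I_def by (intro nn_integral_mono pt)
      also have "\<dots> = ennreal ?K * R + (\<Sum>j\<in>J. ennreal (?D j) * ennreal (exp (- real j) - exp (- (real j + 1))))"
        unfolding R_def by (simp add: nn_integral_add nn_integral_cmult nn_integral_sum nn_integral_cmult_indicator)
      also have "\<dots> = ennreal (?K * r) + (\<Sum>j\<in>J. ennreal (?D j * (exp (- real j) - exp (- (real j + 1)))))"
        using E nonneg r s by (simp add: ennreal_mult)
      also have "\<dots> = ennreal (?K * r + (\<Sum>j\<in>J. ?D j * (exp (- real j) - exp (- (real j + 1)))))"
        using E nonneg r s by (simp add: ennreal_plus sum_nonneg)
      finally have "enn2real (I N) \<le> ?K * r + (\<Sum>j\<in>J. ?D j * (exp (- real j) - exp (- (real j + 1))))"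
        using E nonneg r s by (intro enn2real_leI) (auto intro!: add_nonneg_nonneg sum_nonneg mult_nonneg_nonneg)
      \<comment> \<open>The length of the interval is bounded by \<open>exp (- j)\<close>, which
        cancels \<open>exp (j + 1)\<close> up to the factor \<open>exp 1\<close>.\<close>
      also have "(\<Sum>j\<in>J. ?D j * (exp (- real j) - exp (- (real j + 1)))) \<le> (\<Sum>j\<in>J. ?D j * exp (- real j))"
        using E s by (intro sum_mono mult_left_mono) auto
      also have "\<dots> = exp 1 * E1 ^ (2 * m) * (\<Sum>j\<in>J. s j)"
        unfolding sum_distrib_left by (intro sum.cong refl) (simp add: exp_add exp_minus)
      also have "?K * r = E ^ m * r / l (exp (real a)) ^ m * s a"
        using la by (simp add: s_def field_simps)
      also have "\<dots> \<le> E ^ m * r / l (exp (real a)) ^ m * (\<Sum>j\<in>J. s j)"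
        using E r la s aJ by (intro mult_left_mono member_le_sum) (auto simp: J_def)
      finally show ?thesis
        unfolding C_def J_def s_def by (simp add: algebra_simps)
    qed
    ultimately show ?thesis using lint by (intro exI[of _ C]) auto
  qed
qed

section \<open>Interval probabilities, tail and mean of a single weight\<close>

context prob_space
begin

text \<open>On the interval the power is at least its value at the right end, a loss of
  \<open>exp (- \<tau>)\<close>, and \<open>l\<close> is at least
  \<open>exp (- 2 * \<delta>) * l x\<close> by the Potter bounds. The length
  \<open>(e - 1) * x\<close> is at least \<open>x\<close>.\<close>

lemma prob_interval_ge:
  fixes X :: "'a \<Rightarrow> real"
  assumes D: "distributed M lborel X (\<lambda>h. ennreal (weight_density \<tau> l h))"
    and P: "potter_bounds l \<delta> x0" and \<delta>: "\<delta> > 0" and \<tau>: "\<tau> > 0" and x: "1 \<le> x0" "x0 \<le> x"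
  shows "exp (- (\<tau> + 2 * \<delta>)) * (x powr (1 - \<tau>) * l x) \<le> prob (X -` {x..<exp 1 * x} \<inter> space M)"
proof -
  define c where "c = (exp 1 * x) powr - \<tau> * (exp (- (2 * \<delta>)) * l x)"
  have l: "l x > 0" using P x unfolding potter_bounds_def by blast
  have c: "c \<ge> 0" using l by (simp add: c_def)
  have e: "x \<le> exp 1 * x - x"
    using mult_right_mono[OF exp_ge_add_one_self[of 1], of x] x by simp
  have dens: "c \<le> weight_density \<tau> l h" if h: "h \<in> {x..<exp 1 * x}" for h
  proof -
    have "l x \<le> exp (\<delta> + 1 * \<delta>) * l h"
      using h x by (intro potter_bounds_near(4)[OF P _ _ _ _ \<delta>]) auto
    hence "exp (- (2 * \<delta>)) * l x \<le> exp (- (2 * \<delta>)) * (exp (\<delta> + 1 * \<delta>) * l h)"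
      by (intro mult_left_mono) auto
    also have "\<dots> = l h" by (simp add: mult.assoc[symmetric] exp_add[symmetric])
    finally have "exp (- (2 * \<delta>)) * l x \<le> l h" .
    moreover have "(exp 1 * x) powr - \<tau> \<le> h powr - \<tau>"
      using h x \<tau> by (intro powr_mono2') auto
    ultimately have "c \<le> h powr - \<tau> * l h"
      unfolding c_def using l by (intro mult_mono) auto
    thus ?thesis using h x by (simp add: weight_density_def)
  qed
  have "ennreal (c * x) \<le> ennreal (c * (exp 1 * x - x))"
    using c e by (intro ennreal_leI mult_left_mono)
  also have "\<dots> = ennreal c * ennreal (exp 1 * x - x)"
    using c by (rule ennreal_mult')
  also have "\<dots> = (\<integral>\<^sup>+h. ennreal c * indicator {x..<exp 1 * x} h \<partial>lborel)"
    using x e by (subst nn_integral_cmult_indicator) auto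
  also have "\<dots> \<le> (\<integral>\<^sup>+h. ennreal (weight_density \<tau> l h) * indicator {x..<exp 1 * x} h \<partial>lborel)"
    using dens by (intro nn_integral_mono) (auto simp: indicator_def intro!: ennreal_leI)
  also have "\<dots> = emeasure M (X -` {x..<exp 1 * x} \<inter> space M)"
    using D by (subst distributed_emeasure) auto
  finally have "c * x \<le> prob (X -` {x..<exp 1 * x} \<inter> space M)"
    by (simp add: emeasure_eq_measure ennreal_le_iff)
  moreover have "c * x = exp (- (\<tau> + 2 * \<delta>)) * (x powr (1 - \<tau>) * l x)"
    using x by (simp add: c_def powr_mult exp_powr_real exp_diff exp_minus exp_add powr_diff powr_minus field_simps)
  ultimately show ?thesis by simp
qed

text \<open>The upper half of Karamata's theorem: the Potter bound replaces \<open>l h\<close> by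
  \<open>l x\<close> times a power of \<open>h / x\<close>, and \<open>\<tau> - \<delta> > 1\<close>
  makes the resulting power integrable at infinity.\<close>

lemma tail_le:
  fixes X :: "'a \<Rightarrow> real"
  assumes D: "distributed M lborel X (\<lambda>h. ennreal (weight_density \<tau> l h))"
    and P: "potter_bounds l \<delta> x0" and \<tau>: "\<tau> > 1 + \<delta>" and x: "1 \<le> x0" "x0 \<le> x"
  shows "tail M X x \<le> exp \<delta> / (\<tau> - \<delta> - 1) * (x powr (1 - \<tau>) * l x)"
proof -
  define c where "c = exp \<delta> * x powr - \<delta> * l x"
  have l: "l x > 0" using P x unfolding potter_bounds_def by blast
  have c: "c \<ge> 0" using l by (simp add: c_def)
  have dens: "weight_density \<tau> l h \<le> c * h powr - (\<tau> - \<delta>)" if h: "h \<ge> x" for h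
  proof -
    have "weight_density \<tau> l h = h powr - \<tau> * l h" using h x by (simp add: weight_density_def)
    also have "\<dots> \<le> h powr - \<tau> * (exp \<delta> * (h / x) powr \<delta> * l x)"
      using P h x unfolding potter_bounds_def by (intro mult_left_mono) auto
    also have "\<dots> = c * h powr - (\<tau> - \<delta>)"
      using h x by (simp add: c_def powr_divide powr_diff powr_minus field_simps)
    finally show ?thesis .
  qed
  have "emeasure M (X -` {x<..} \<inter> space M)
      = (\<integral>\<^sup>+h. ennreal (weight_density \<tau> l h) * indicator {x<..} h \<partial>lborel)"
    using D by (subst distributed_emeasure) auto
  also have "\<dots> \<le> (\<integral>\<^sup>+h. ennreal c * (ennreal (h powr - (\<tau> - \<delta>)) * indicator {x..} h) \<partial>lborel)"
    using dens c by (intro nn_integral_mono) (auto simp: indicator_def ennreal_mult[symmetric] intro!: ennreal_leI)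
  also have "\<dots> = ennreal c * (\<integral>\<^sup>+h. ennreal (h powr - (\<tau> - \<delta>)) * indicator {x..} h \<partial>lborel)"
    by (subst nn_integral_cmult) auto
  also have "\<dots> = ennreal (c * (x powr (1 - (\<tau> - \<delta>)) / (\<tau> - \<delta> - 1)))"
    using \<tau> x c by (subst nn_integral_powr_atLeast) (auto simp: ennreal_mult'[symmetric])
  also have "c * (x powr (1 - (\<tau> - \<delta>)) / (\<tau> - \<delta> - 1)) = exp \<delta> / (\<tau> - \<delta> - 1) * (x powr (1 - \<tau>) * l x)"
    using x by (simp add: c_def powr_diff powr_minus powr_add) (simp add: field_simps)
  finally have "prob (X -` {x<..} \<inter> space M) \<le> exp \<delta> / (\<tau> - \<delta> - 1) * (x powr (1 - \<tau>) * l x)"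
    using \<tau> l by (simp add: emeasure_eq_measure ennreal_le_iff)
  moreover have "X -` {x<..} \<inter> space M = {\<omega> \<in> space M. X \<omega> > x}" by auto
  ultimately show ?thesis by (simp add: tail_def)
qed

lemma AE_weight_ge_1:
  fixes X :: "'a \<Rightarrow> real"
  assumes D: "distributed M lborel X (\<lambda>h. ennreal (weight_density \<tau> l h))"
  shows "AE \<omega> in M. X \<omega> \<ge> 1"
  by (subst distributed_AE2[OF D]) (auto simp: weight_density_def)

text \<open>The point is integrability, since otherwise the expectation would be the default value
  0. The Potter bound and \<open>\<tau> - \<delta> - 1 > 1\<close> control the large
  weights.\<close>

lemma expectation_weight_ge_1:
  fixes X :: "'a \<Rightarrow> real"
  assumes D: "distributed M lborel X (\<lambda>h. ennreal (weight_density \<tau> l h))"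
    and P: "potter_bounds l \<delta> x0" and \<tau>: "\<tau> > 2 + \<delta>" and x: "1 \<le> x0"
    and nonneg: "\<And>h. l h \<ge> 0"
  shows "expectation X \<ge> 1"
proof -
  define c where "c = exp \<delta> * x0 powr - \<delta> * l x0"
  have l: "l x0 > 0" using P x unfolding potter_bounds_def by blast
  have c: "c \<ge> 0" using l by (simp add: c_def)
  let ?w = "weight_density \<tau> l"
  have w: "?w h \<ge> 0" for h using nonneg by (simp add: weight_density_def)
  note [measurable] = distributed_borel_measurable[OF D, simplified]
  have dens: "?w h * h \<le> c * h powr - (\<tau> - \<delta> - 1)" if h: "h \<ge> x0" for h
  proof -
    have "?w h * h = h powr - \<tau> * l h * h" using h x by (simp add: weight_density_def)
    also have "\<dots> \<le> h powr - \<tau> * (exp \<delta> * (h / x0) powr \<delta> * l x0) * h"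
      using P h x unfolding potter_bounds_def by (intro mult_right_mono mult_left_mono) auto
    also have "\<dots> = c * h powr - (\<tau> - \<delta> - 1)"
      using h x by (simp add: c_def powr_divide powr_diff powr_minus powr_add field_simps)
    finally show ?thesis .
  qed
  \<comment> \<open>Below \<open>x0\<close> the factor \<open>h\<close> is bounded by
    \<open>x0\<close> and the total mass 1 of the density suffices; above \<open>x0\<close> the
    power bound takes over.\<close>
  have bound: "ennreal (?w h) * ennreal h
      \<le> ennreal x0 * ennreal (?w h) + ennreal c * (ennreal (h powr - (\<tau> - \<delta> - 1)) * indicator {x0..} h)" for h
  proof (cases "h \<ge> x0")
    case True
    have "ennreal (?w h) * ennreal h = ennreal (?w h * h)"
      using w by (simp add: ennreal_mult')
    also have "\<dots> \<le> ennreal (c * h powr - (\<tau> - \<delta> - 1))"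
      by (intro ennreal_leI dens True)
    also have "\<dots> = ennreal c * ennreal (h powr - (\<tau> - \<delta> - 1))"
      using c by (rule ennreal_mult')
    finally show ?thesis using True by (simp add: add_increasing)
  next
    case False
    hence "ennreal (?w h) * ennreal h \<le> ennreal (?w h) * ennreal x0"
      by (intro mult_left_mono ennreal_leI) auto
    thus ?thesis by (simp add: add_increasing2 mult.commute)
  qed
  have "(\<integral>\<^sup>+\<omega>. ennreal (X \<omega>) \<partial>M) = (\<integral>\<^sup>+h. ennreal (?w h) * ennreal h \<partial>lborel)"
    by (rule distributed_nn_integral[OF D, symmetric]) auto
  also have "\<dots> \<le> (\<integral>\<^sup>+h. ennreal x0 * ennreal (?w h)
      + ennreal c * (ennreal (h powr - (\<tau> - \<delta> - 1)) * indicator {x0..} h) \<partial>lborel)"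
    by (intro nn_integral_mono bound)
  also have "\<dots> = ennreal x0 * (\<integral>\<^sup>+h. ennreal (?w h) \<partial>lborel)
      + ennreal c * (\<integral>\<^sup>+h. ennreal (h powr - (\<tau> - \<delta> - 1)) * indicator {x0..} h \<partial>lborel)"
    by (simp add: nn_integral_add nn_integral_cmult)
  also have "(\<integral>\<^sup>+h. ennreal (?w h) \<partial>lborel) = 1"
    using distributed_nn_integral[OF D, of "\<lambda>_. 1"] by (simp add: emeasure_space_1)
  also have "(\<integral>\<^sup>+h. ennreal (h powr - (\<tau> - \<delta> - 1)) * indicator {x0..} h \<partial>lborel)
      = ennreal (x0 powr (1 - (\<tau> - \<delta> - 1)) / (\<tau> - \<delta> - 1 - 1))"
    using \<tau> x by (intro nn_integral_powr_atLeast) auto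
  also have "ennreal x0 * 1 + ennreal c * \<dots> < \<infinity>"
    by (simp add: ennreal_mult_less_top)
  finally have "(\<integral>\<^sup>+\<omega>. ennreal (X \<omega>) \<partial>M) < \<infinity>" .
  moreover have "AE \<omega> in M. 0 \<le> X \<omega>" using AE_weight_ge_1[OF D] by eventually_elim simp
  moreover have "X \<in> borel_measurable M" using distributed_measurable[OF D] by simp
  ultimately have "integrable M X" by (intro integrableI_nonneg)
  thus ?thesis by (rule integral_ge_const[OF _ AE_weight_ge_1[OF D]])
qed

end

section \<open>Lower bound for the cycle probability\<close>

lemma prod_alternating:
  "(\<Prod>i<2 * m. if even i then x else y) = x ^ m * (y :: 'b :: comm_monoid_mult) ^ m"
  by (induction m) (simp_all add: mult_ac)

text \<open>Each scale \<open>j\<close> yields an event \<open>Ev j\<close> on which all edges are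
  certain. Even length lets the alternation of low and high weights close up around the
  cycle.\<close>

lemma (in prob_space) cycle_prob_ge:
  fixes H :: "nat \<Rightarrow> 'a \<Rightarrow> real"
  assumes ind: "indep_vars (\<lambda>_. borel) H UNIV"
    and D: "\<And>i. distributed M lborel (H i) (\<lambda>h. ennreal (weight_density \<tau> l h))"
    and P: "potter_bounds l \<delta> (exp (real a))" and \<delta>: "\<delta> > 0" and \<tau>: "\<tau> > 0"
    and m: "m > 0" and N: "N = expectation (H 0) * real n" "exp (real a + 1) \<le> sqrt N"
  shows "exp (- (\<tau> + 2 * \<delta>)) ^ (2 * m) * N powr ((1 - \<tau>) * real m)
      * (\<Sum>j=a..nat \<lfloor>ln N / 2\<rfloor>. l (exp (real j)) ^ m * l (N / exp (real j)) ^ m)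
    \<le> cycle_prob M H (2 * m) n"
proof -
  define J where "J = {a..nat \<lfloor>ln N / 2\<rfloor>}"
  define c where "c = exp (- (\<tau> + 2 * \<delta>))"
  define lo where "lo j i = (if even i then exp (real j) else N / exp (real j))" for i j :: nat
  define A where "A j i = {lo j i..<exp 1 * lo j i}" for i j :: nat
  define Ev where "Ev j = (\<Inter>i\<in>{..<2 * m}. H i -` A j i \<inter> space M)" for j
  define q where "q \<omega> = (\<Prod>i<2 * m. conn_prob (expectation (H 0)) n (H i \<omega>) (H (Suc i mod (2 * m)) \<omega>))" for \<omega>
  have rv [measurable]: "random_variable borel (H i)" for i
    using ind by (auto simp: indep_vars_def)
  have sN: "sqrt N > 0" by (rule less_le_trans[OF exp_gt_zero N(2)])
  hence N0: "N > 0" by simp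
  \<comment> \<open>Both ends of an edge are in the Potter range: \<open>exp j \<le> sqrt N\<close>
    keeps the high weight level \<open>N / exp j\<close> above \<open>exp a\<close>.\<close>
  have lo_ge: "exp (real a) \<le> lo j i" if "j \<in> J" for i j
  proof (cases "even i")
    case True
    thus ?thesis using that by (simp add: lo_def J_def)
  next
    case False
    have "ln N / 2 \<ge> 0"
    proof -
      have "0 \<le> ln (sqrt N)" using N(2) sN order.trans[of 1 "exp (real a + 1)" "sqrt N"] by simp
      thus ?thesis using N0 by (simp add: ln_sqrt)
    qed
    hence "real j \<le> ln N / 2" using that unfolding J_def by (simp add: le_nat_iff le_floor_iff)
    hence "exp (real j) \<le> exp (ln N / 2)" by simp
    also have "exp (ln N / 2) = sqrt N" using N0 exp_ln[of "sqrt N"] by (simp add: ln_sqrt)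
    finally have "exp (real a) * exp (real j) \<le> sqrt N * sqrt N"
      using order.trans[OF _ N(2), of "exp (real a)"] sN by (intro mult_mono) auto
    hence "exp (real a) \<le> N / exp (real j)" using N0 by (simp add: field_simps)
    thus ?thesis using False by (simp add: lo_def)
  qed
  have prob_Ev: "c ^ (2 * m) * N powr ((1 - \<tau>) * real m) * (l (exp (real j)) ^ m * l (N / exp (real j)) ^ m)
      \<le> prob (Ev j)" if j: "j \<in> J" for j
  proof -
    let ?b = "\<lambda>i. c * (lo j i powr (1 - \<tau>) * l (lo j i))"
    have "(\<Prod>i<2 * m. ?b i) \<le> (\<Prod>i<2 * m. prob (H i -` A j i \<inter> space M))"
    proof (rule prod_mono)
      fix i assume "i \<in> {..<2 * m}"
      have "l (lo j i) > 0" using P lo_ge[OF j] unfolding potter_bounds_def by blast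
      moreover have "?b i \<le> prob (H i -` A j i \<inter> space M)"
        unfolding c_def A_def using lo_ge[OF j] by (intro prob_interval_ge[OF D P \<delta> \<tau>]) auto
      ultimately show "0 \<le> ?b i \<and> ?b i \<le> prob (H i -` A j i \<inter> space M)"
        by (simp add: c_def)
    qed
    also have "\<dots> = prob (Ev j)"
      unfolding Ev_def using m by (subst indep_varsD[OF ind]) (auto simp: A_def lessThan_empty_iff)
    also have "(\<Prod>i<2 * m. ?b i) = (\<Prod>i<2 * m. if even i then c * (exp (real j) powr (1 - \<tau>) * l (exp (real j)))
        else c * ((N / exp (real j)) powr (1 - \<tau>) * l (N / exp (real j))))"
      by (intro prod.cong) (auto simp: lo_def)
    also have "\<dots> = c ^ (2 * m) * (exp (real j) powr (1 - \<tau>) * (N / exp (real j)) powr (1 - \<tau>)) ^ m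
        * (l (exp (real j)) ^ m * l (N / exp (real j)) ^ m)"
      unfolding prod_alternating unfolding mult_2 power_add by (simp add: power_mult_distrib mult_ac)
    \<comment> \<open>The powers of \<open>exp j\<close> cancel between neighbours, so the prefactor
      is the same at every scale.\<close>
    also have "exp (real j) powr (1 - \<tau>) * (N / exp (real j)) powr (1 - \<tau>) = N powr (1 - \<tau>)"
      using N0 by (subst powr_mult[symmetric]) auto
    also have "(N powr (1 - \<tau>)) ^ m = N powr ((1 - \<tau>) * real m)"
      using N0 by (simp add: powr_powr powr_realpow[symmetric])
    finally show ?thesis .
  qed
  have q_Ev: "q \<omega> = 1" if "\<omega> \<in> Ev j" for \<omega> j
    unfolding q_def
  proof (intro prod.neutral ballI)
    fix i assume i: "i \<in> {..<2 * m}"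
    have s: "Suc i mod (2 * m) \<in> {..<2 * m}" using m by simp
    \<comment> \<open>Reduction modulo the even number \<open>2 * m\<close> preserves parity, so the
      closing edge also joins an even and an odd index.\<close>
    have par: "even (Suc i mod (2 * m)) \<longleftrightarrow> odd i"
      by (simp add: dvd_mod_iff)
    have lopos: "lo j i > 0" for i using N0 by (simp add: lo_def)
    have "N = lo j i * lo j (Suc i mod (2 * m))"
      using par by (simp add: lo_def)
    also have "\<dots> \<le> H i \<omega> * H (Suc i mod (2 * m)) \<omega>"
    proof -
      have "H i' \<omega> \<in> A j i'" if "i' \<in> {..<2 * m}" for i'
        using \<open>\<omega> \<in> Ev j\<close> that unfolding Ev_def by blast
      from this[OF i] this[OF s]
      have "lo j i \<le> H i \<omega>" "lo j (Suc i mod (2 * m)) \<le> H (Suc i mod (2 * m)) \<omega>"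
        by (auto simp: A_def)
      thus ?thesis using lopos[of i] lopos[of "Suc i mod (2 * m)"] by (intro mult_mono) auto
    qed
    finally show "conn_prob (expectation (H 0)) n (H i \<omega>) (H (Suc i mod (2 * m)) \<omega>) = 1"
      using N0 unfolding conn_prob_def N(1)[symmetric] by simp
  qed
  have Ev_meas [measurable]: "Ev j \<in> events" for j
    unfolding Ev_def A_def using m by (intro sets.finite_INT) (auto simp: lessThan_empty_iff)
  have "c ^ (2 * m) * N powr ((1 - \<tau>) * real m) * (\<Sum>j\<in>J. l (exp (real j)) ^ m * l (N / exp (real j)) ^ m)
      \<le> (\<Sum>j\<in>J. prob (Ev j))"
    unfolding sum_distrib_left by (intro sum_mono prob_Ev)
  also have "\<dots> = prob (\<Union>j\<in>J. Ev j)"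
  proof (rule finite_measure_finite_Union[symmetric])
    \<comment> \<open>The weight of vertex 0 alone determines \<open>j\<close>, through the
      half-open interval from \<open>exp j\<close> to \<open>exp (j + 1)\<close>.\<close>
    show "disjoint_family_on Ev J"
    unfolding disjoint_family_on_def
    proof (intro ballI impI, rule ccontr)
      fix j j' assume "j \<noteq> j'" "Ev j \<inter> Ev j' \<noteq> {}"
      then obtain \<omega> where "\<omega> \<in> Ev j" "\<omega> \<in> Ev j'" by auto
      moreover have "0 \<in> {..<2 * m}" using m by simp
      ultimately have "H 0 \<omega> \<in> A j 0" "H 0 \<omega> \<in> A j' 0" unfolding Ev_def by blast+
      hence "exp (real j) < exp (real j' + 1)" "exp (real j') < exp (real j + 1)"
        by (auto simp: A_def lo_def exp_add mult.commute)
      thus False using \<open>j \<noteq> j'\<close> by simp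
    qed
  qed (auto simp: J_def)
  also have "\<dots> = expectation (indicator (\<Union>j\<in>J. Ev j))"
    by (subst Bochner_Integration.integral_indicator)
       (auto simp: J_def Int_absorb2 intro!: arg_cong[where f = prob] dest: sets.sets_into_space[OF Ev_meas, THEN subsetD])
  also have "\<dots> \<le> expectation q"
  proof (rule integral_mono_AE)
    have q_meas [measurable]: "q \<in> borel_measurable M"
      unfolding q_def conn_prob_def by measurable
    have "AE \<omega> in M. \<forall>i. H i \<omega> \<ge> 1"
      using AE_weight_ge_1[OF D] by (simp add: AE_all_countable)
    hence q: "AE \<omega> in M. 0 \<le> q \<omega> \<and> q \<omega> \<le> 1"
    proof eventually_elim
      case (elim \<omega>)
      have "H i \<omega> \<ge> 0" for i using elim order.trans[of 0 1 "H i \<omega>"] by simp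
      moreover have "expectation (H 0) * real n \<ge> 0" using N0 N(1) by simp
      ultimately have "0 \<le> conn_prob (expectation (H 0)) n (H i \<omega>) (H j \<omega>)" for i j
        unfolding conn_prob_def by simp
      thus ?case unfolding q_def
        by (auto intro!: prod_nonneg prod_le_1 simp: conn_prob_def)
    qed
    show "integrable M q"
      by (rule integrable_const_bound[where B = 1]) (use q in auto)
    show "integrable M (indicator (\<Union>j\<in>J. Ev j) :: 'a \<Rightarrow> real)"
      by (rule integrable_const_bound[where B = 1]) (auto simp: indicator_def J_def)
    show "AE \<omega> in M. indicator (\<Union>j\<in>J. Ev j) \<omega> \<le> q \<omega>"
      using q by eventually_elim (auto simp: indicator_def q_Ev)
  qed
  also have "\<dots> = cycle_prob M H (2 * m) n"
    unfolding q_def cycle_prob_def ..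
  finally show ?thesis unfolding c_def J_def .
qed

section \<open>Comparison of the cycle count with the integral\<close>

text \<open>Both sides are measured against the same quantity \<open>W\<close>: the cycle count is
  at least \<open>\<alpha> * W\<close> and the right-hand side is at most
  \<open>\<beta> * W\<close>.\<close>

lemma (in prob_space) avg_cycles_gtrsim:
  fixes H :: "nat \<Rightarrow> 'a \<Rightarrow> real"
  assumes \<tau>: "\<tau> > 2" and sv: "slowly_varying l"
    and nonneg: "\<And>h. l h \<ge> 0" and meas: "l \<in> borel_measurable borel"
    and ind: "indep_vars (\<lambda>_. borel) H UNIV"
    and D: "\<And>i. distributed M lborel (H i) (\<lambda>h. ennreal (weight_density \<tau> l h))"
    and \<mu>: "\<mu> = expectation (H 0)" and m: "m \<ge> 2"
  shows "avg_cycles M H (2 * m) \<greatersim>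
    (\<lambda>n. real n ^ (2 * m) * tail M (H 0) (sqrt (real n)) ^ (2 * m) *
      (LINT h:{sqrt (real n * \<mu>)..real n * \<mu>}|lborel.
         1 / h * (l h ^ m * l (real n * \<mu> / h) ^ m / l (sqrt (real n * \<mu>)) ^ (2 * m))))"
proof -
  \<comment> \<open>Half of the available room, so that \<open>\<tau> > 2 + \<delta>\<close> still
    gives a finite mean.\<close>
  define \<delta> where "\<delta> = (\<tau> - 2) / 2"
  have \<delta>: "\<delta> > 0" "\<tau> > 2 + \<delta>" "\<tau> > 1 + \<delta>" using \<tau> by (auto simp: \<delta>_def field_simps)
  obtain a :: nat where P: "potter_bounds l \<delta> (exp (real a))"
    using slowly_varying_potter_bounds[OF sv nonneg meas \<delta>(1)] by blast
  obtain C where C: "C > 0" and C_le: "\<And>N. exp (real a + 1) \<le> sqrt N \<Longrightarrow>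
    (LINT h:{sqrt N..N}|lborel. 1 / h * (l h ^ m * l (N / h) ^ m))
      \<le> C * (\<Sum>j=a..nat \<lfloor>ln N / 2\<rfloor>. l (exp (real j)) ^ m * l (N / exp (real j)) ^ m)"
    using alternating_integral_upper_bound[OF P \<delta>(1) nonneg meas] by blast
  have \<mu>1: "\<mu> \<ge> 1"
    unfolding \<mu> by (rule expectation_weight_ge_1[OF D P \<delta>(2) _ nonneg]) simp
  have H0: "AE \<omega> in M. H i \<omega> \<ge> 0" for i
    using AE_weight_ge_1[OF D, of i] by eventually_elim simp
  have law: "distr M borel (H i) = density lborel (\<lambda>h. ennreal (weight_density \<tau> l h))" for i
    using distributed_distr_eq_density[OF D, of i] by (simp cong: distr_cong)
  note avg = avg_cycles_eq[OF prob_space_axioms ind law H0]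
  define k where "k = 2 * m"
  have k: "k \<ge> 3" "k > 0" using m by (auto simp: k_def)
  \<comment> \<open>The Potter cost of moving from \<open>sqrt n\<close>, where the tail is
    evaluated, to \<open>sqrt (n * \<mu>)\<close>, a factor \<open>sqrt \<mu>\<close> away.\<close>
  define K where "K = exp (\<delta> + ln (sqrt \<mu>) * \<delta>)"
  define T where "T = exp \<delta> / (\<tau> - \<delta> - 1)"
  \<comment> \<open>The factor \<open>1 / k ^ k\<close> comes from
    \<open>(n / k) ^ k \<le> n choose k\<close>, the exponential from the interval probabilities,
    and the power of \<open>\<mu>\<close> from writing \<open>N = n * \<mu>\<close>.\<close>
  define \<alpha> where "\<alpha> = fact k / (2 * real k) / real k ^ k * exp (- (\<tau> + 2 * \<delta>)) ^ k * \<mu> powr ((1 - \<tau>) * real m)"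
  define \<beta> where "\<beta> = (T * K) ^ k * C"
  have KT: "K > 0" "T > 0" using \<delta> by (auto simp: K_def T_def)
  have \<alpha>\<beta>: "\<alpha> > 0" "\<beta> > 0" using KT C \<mu>1 k by (auto simp: \<alpha>_def \<beta>_def)
  have "filterlim (\<lambda>n. sqrt (real n)) at_top sequentially"
    by (rule filterlim_compose[OF sqrt_at_top filterlim_real_sequentially])
  hence "eventually (\<lambda>n. sqrt (real n) \<ge> exp (real a + 1)) sequentially"
    by (auto simp: filterlim_at_top)
  moreover have "eventually (\<lambda>n. n \<ge> k) sequentially" by (rule eventually_ge_at_top)
  ultimately have "eventually (\<lambda>n. 0 < avg_cycles M H k n \<and>
      0 \<le> real n ^ k * tail M (H 0) (sqrt (real n)) ^ k *
      (LINT h:{sqrt (real n * \<mu>)..real n * \<mu>}|lborel.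
         1 / h * (l h ^ m * l (real n * \<mu> / h) ^ m / l (sqrt (real n * \<mu>)) ^ k)) \<and>
      \<alpha> / \<beta> * (real n ^ k * tail M (H 0) (sqrt (real n)) ^ k *
      (LINT h:{sqrt (real n * \<mu>)..real n * \<mu>}|lborel.
         1 / h * (l h ^ m * l (real n * \<mu> / h) ^ m / l (sqrt (real n * \<mu>)) ^ k)))
      \<le> avg_cycles M H k n) sequentially"
  proof eventually_elim
    case (elim n)
    define N where "N = real n * \<mu>"
    define S where "S = (\<Sum>j=a..nat \<lfloor>ln N / 2\<rfloor>. l (exp (real j)) ^ m * l (N / exp (real j)) ^ m)"
    define I where "I = (LINT h:{sqrt N..N}|lborel. 1 / h * (l h ^ m * l (N / h) ^ m))"
    define W where "W = real n ^ k * real n powr ((1 - \<tau>) * real m) * S"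
    define t where "t = tail M (H 0) (sqrt (real n))"
    have n0: "real n > 0" using elim k by simp
    have "sqrt (real n) \<le> sqrt N" using n0 \<mu>1 by (simp add: N_def)
    hence N: "exp (real a + 1) \<le> sqrt N" using elim by linarith
    have sN: "sqrt N > 0" by (rule less_le_trans[OF exp_gt_zero N])
    hence N0: "N > 0" by simp
    have "sqrt N * 1 \<le> sqrt N * sqrt N"
      using sN order.trans[OF _ N, of 1] by (intro mult_left_mono) auto
    hence NsN: "sqrt N \<le> N" using N0 by simp
    have ea: "exp (real a) \<le> exp (real a + 1)" by simp
    have sn: "exp (real a) \<le> sqrt (real n)" using ea elim by linarith
    have lN: "l (sqrt N) > 0"
      using P ea N unfolding potter_bounds_def by (meson order.refl order.trans)
    \<comment> \<open>One positive term, \<open>j = a\<close>, is enough; it makes \<open>W\<close>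
      and hence the cycle count strictly positive, as \<open>gtrsimI\<close> demands.\<close>
    have S0: "S > 0"
    proof -
      have "real a + 1 \<le> ln (sqrt N)" using N sN by (simp add: ln_ge_iff)
      hence "real a + 1 \<le> ln N / 2" using N0 by (simp add: ln_sqrt)
      hence "a \<le> nat \<lfloor>ln N / 2\<rfloor>" by linarith
      hence "a \<in> {a..nat \<lfloor>ln N / 2\<rfloor>}" by simp
      moreover have "l (exp (real a)) ^ m * l (N / exp (real a)) ^ m > 0"
      proof -
        have "exp (real a) * exp (real a) \<le> sqrt N * sqrt N"
          using order.trans[OF ea N] sN by (intro mult_mono) auto
        hence "exp (real a) \<le> N / exp (real a)" using N0 by (simp add: field_simps)
        thus ?thesis using P unfolding potter_bounds_def by (auto intro!: mult_pos_pos zero_less_power)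
      qed
      ultimately show ?thesis unfolding S_def using nonneg
        by (intro sum_pos2[of _ a]) auto
    qed
    have W: "W > 0" unfolding W_def using S0 n0 by simp
    have I0: "I \<ge> 0"
      unfolding I_def set_lebesgue_integral_def
    proof (intro Bochner_Integration.integral_nonneg)
      fix h :: real
      show "0 \<le> indicator {sqrt N..N} h *\<^sub>R (1 / h * (l h ^ m * l (N / h) ^ m))"
        using nonneg less_le_trans[OF sN, of h] by (cases "h \<in> {sqrt N..N}") auto
    qed
    have powr_N: "N powr ((1 - \<tau>) * real m) = \<mu> powr ((1 - \<tau>) * real m) * real n powr ((1 - \<tau>) * real m)"
      using n0 \<mu>1 by (simp add: N_def powr_mult mult.commute)
    have "\<alpha> * W = fact k / (2 * real k) * (real n / real k) ^ k
        * (exp (- (\<tau> + 2 * \<delta>)) ^ k * N powr ((1 - \<tau>) * real m) * S)"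
      unfolding \<alpha>_def W_def powr_N by (simp add: power_divide)
    also have "\<dots> \<le> fact k / (2 * real k) * real (n choose k) * cycle_prob M H k n"
    proof (intro mult_mono mult_left_mono mult_nonneg_nonneg)
      show "(real n / real k) ^ k \<le> real (n choose k)"
        using binomial_ge_n_over_k_pow_k[of k n, where 'a = real] elim by simp
      show "exp (- (\<tau> + 2 * \<delta>)) ^ k * N powr ((1 - \<tau>) * real m) * S \<le> cycle_prob M H k n"
        unfolding k_def S_def using \<delta> m N by (intro cycle_prob_ge[OF ind D P]) (auto simp: N_def \<mu> mult.commute)
    qed (use S0 in auto)
    also have "\<dots> = avg_cycles M H k n" using avg[of k n] k by simp
    finally have g1: "\<alpha> * W \<le> avg_cycles M H k n" .
    have t0: "t \<ge> 0" by (simp add: t_def tail_def)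
    have "t \<le> T * (sqrt (real n) powr (1 - \<tau>) * l (sqrt (real n)))"
      unfolding t_def T_def using sn by (intro tail_le[OF D P \<delta>(3)]) auto
    also have "\<dots> \<le> T * (sqrt (real n) powr (1 - \<tau>) * (K * l (sqrt N)))"
    proof (intro mult_left_mono)
      show "l (sqrt (real n)) \<le> K * l (sqrt N)"
        unfolding K_def using sn n0 \<mu>1 \<delta>
        by (intro potter_bounds_near(4)[OF P]) (auto simp: N_def real_sqrt_mult)
    qed (use KT in auto)
    finally have "t \<le> T * K * sqrt (real n) powr (1 - \<tau>) * l (sqrt N)"
      using KT by (simp add: mult_ac)
    hence "t ^ k \<le> (T * K * sqrt (real n) powr (1 - \<tau>) * l (sqrt N)) ^ k"
      using t0 by (intro power_mono)
    also have "\<dots> = (T * K) ^ k * (sqrt (real n) powr (1 - \<tau>)) ^ k * l (sqrt N) ^ k"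
      by (simp add: power_mult_distrib)
    \<comment> \<open>The square root halves the exponent \<open>k = 2 * m\<close>, which gives the
      same power of \<open>n\<close> as in the lower bound.\<close>
    also have "(sqrt (real n) powr (1 - \<tau>)) ^ k = real n powr ((1 - \<tau>) * real m)"
    proof -
      have "(sqrt (real n) powr (1 - \<tau>)) ^ k = sqrt (real n) powr ((1 - \<tau>) * real k)"
        using n0 by (simp add: powr_powr powr_realpow[symmetric])
      also have "\<dots> = (real n powr (1 / 2)) powr ((1 - \<tau>) * real k)"
        using n0 by (simp add: powr_half_sqrt)
      also have "\<dots> = real n powr ((1 - \<tau>) * real m)"
        unfolding powr_powr k_def by simp
      finally show ?thesis .
    qed
    finally have tk: "t ^ k / l (sqrt N) ^ k \<le> (T * K) ^ k * real n powr ((1 - \<tau>) * real m)"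
      using lN by (simp add: field_simps)
    have Q: "(LINT h:{sqrt N..N}|lborel. 1 / h * (l h ^ m * l (N / h) ^ m / l (sqrt N) ^ k)) = I / l (sqrt N) ^ k"
      unfolding I_def by (simp add: set_integral_divide_zero[symmetric])
    have "real n ^ k * t ^ k * (I / l (sqrt N) ^ k) = real n ^ k * ((t ^ k / l (sqrt N) ^ k) * I)"
      by simp
    also have "\<dots> \<le> real n ^ k * (((T * K) ^ k * real n powr ((1 - \<tau>) * real m)) * (C * S))"
      using tk C_le[OF N] I0 KT unfolding I_def S_def
      by (intro mult_left_mono mult_mono) auto
    also have "\<dots> = \<beta> * W" by (simp add: \<beta>_def W_def)
    finally have g2: "real n ^ k * t ^ k * (I / l (sqrt N) ^ k) \<le> \<beta> * W" .
    have "0 < \<alpha> * W" using \<alpha>\<beta> W by simp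
    hence 1: "0 < avg_cycles M H k n" using g1 by linarith
    have 2: "0 \<le> real n ^ k * t ^ k * (I / l (sqrt N) ^ k)"
      using I0 t0 lN by simp
    have "\<alpha> / \<beta> * (real n ^ k * t ^ k * (I / l (sqrt N) ^ k)) \<le> \<alpha> / \<beta> * (\<beta> * W)"
      using g2 \<alpha>\<beta> by (intro mult_left_mono) auto
    also have "\<dots> = \<alpha> * W" using \<alpha>\<beta> by simp
    also note g1
    finally show ?case
      using 1 2 unfolding N_def[symmetric] Q t_def[symmetric] by blast
  qed
  thus ?thesis
    unfolding k_def using \<alpha>\<beta> by (intro gtrsimI[of "\<alpha> / \<beta>"]) auto
qed

section \<open>Reduction to a globally nonnegative measurable factor\<close>

theorem theorem2p3:
  fixes M :: "'a measure" and H :: "nat \<Rightarrow> 'a \<Rightarrow> real"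
    and l :: "real \<Rightarrow> real" and \<tau> \<mu> :: real and k :: nat
  assumes "prob_space M"
    and "2 < \<tau>" and "\<tau> < 3"
    and "slowly_varying l"
    and "\<And>h. h \<ge> 1 \<Longrightarrow> l h \<ge> 0"
    and "prob_space.indep_vars M (\<lambda>_. borel) H UNIV"
    and "\<And>i. distributed M lborel (H i) (\<lambda>h. ennreal (weight_density \<tau> l h))"
    and "\<mu> = integral\<^sup>L M (H 0)"
    and "even k" and "k \<ge> 4"
  shows "avg_cycles M H k \<greatersim>
    (\<lambda>n. real n ^ k * tail M (H 0) (sqrt (real n)) ^ k *
      (LINT h:{sqrt (real n * \<mu>)..real n * \<mu>}|lborel.
         1 / h * (l h ^ (k div 2) * l (real n * \<mu> / h) ^ (k div 2) / l (sqrt (real n * \<mu>)) ^ k)))"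
proof -
  interpret prob_space M by fact
  \<comment> \<open>Cutting \<open>l\<close> off below 1 changes neither the density nor the
    behaviour at infinity, and makes the function nonnegative everywhere.\<close>
  define L where "L h = (if 1 \<le> h then l h else 0)" for h
  define m where "m = k div 2"
  have m: "k = 2 * m" "m \<ge> 2" using assms(9,10) by (auto simp: m_def)
  have L: "L h \<ge> 0" for h using assms(5) by (simp add: L_def)
  have wL: "weight_density \<tau> L = weight_density \<tau> l"
    by (auto simp: weight_density_def L_def)
  have [measurable]: "(\<lambda>h. ennreal (weight_density \<tau> l h)) \<in> borel_measurable borel"
    using distributed_borel_measurable[OF assms(7)] by simp
  \<comment> \<open>Measurability is recovered from the density by multiplying the power
    \<open>h powr - \<tau>\<close> away.\<close>
  have "L = (\<lambda>h. h powr \<tau> * enn2real (ennreal (weight_density \<tau> l h)))"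
    using assms(5) by (auto simp: L_def weight_density_def powr_minus)
  moreover have "(\<lambda>h. h powr \<tau> * enn2real (ennreal (weight_density \<tau> l h))) \<in> borel_measurable borel"
    by measurable
  ultimately have L_meas: "L \<in> borel_measurable borel" by simp
  have L_sv: "slowly_varying L"
    unfolding slowly_varying_def
  proof (intro allI impI)
    fix c :: real assume c: "c > 0"
    have "eventually (\<lambda>h. l (c * h) / l h = L (c * h) / L h) at_top"
      using eventually_ge_at_top[of "max 1 (1 / c)"]
    proof eventually_elim
      case (elim h)
      thus ?case using c by (auto simp: L_def field_simps)
    qed
    moreover have "((\<lambda>h. l (c * h) / l h) \<longlongrightarrow> 1) at_top"
      using assms(4) c unfolding slowly_varying_def by blast
    ultimately show "((\<lambda>h. L (c * h) / L h) \<longlongrightarrow> 1) at_top"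
      by (rule Lim_transform_eventually[rotated])
  qed
  have "(\<integral>h\<in>{sqrt N..N}. (1 / h * (l h ^ m * l (N / h) ^ m / l (sqrt N) ^ k)) \<partial>lborel)
      = (\<integral>h\<in>{sqrt N..N}. (1 / h * (L h ^ m * L (N / h) ^ m / L (sqrt N) ^ k)) \<partial>lborel)"
    if "N = 0 \<or> N \<ge> 1" for N
  proof (cases "N = 0")
    \<comment> \<open>This case occurs at \<open>n = 0\<close>: the range is the single point 0,
      where \<open>1 / h\<close> is 0 by convention.\<close>
    case True
    thus ?thesis unfolding set_lebesgue_integral_def
      by (intro Bochner_Integration.integral_cong) (auto simp: indicator_def)
  next
    case False
    hence "1 \<le> sqrt N" using that by simp
    show ?thesis
    proof (intro set_lebesgue_integral_cong allI impI)
      fix h assume h: "h \<in> {sqrt N..N}"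
      hence "1 \<le> h" using order.trans[OF \<open>1 \<le> sqrt N\<close>, of h] by simp
      moreover from this h have "1 \<le> N / h" by (simp add: field_simps)
      ultimately show "1 / h * (l h ^ m * l (N / h) ^ m / l (sqrt N) ^ k)
          = 1 / h * (L h ^ m * L (N / h) ^ m / L (sqrt N) ^ k)"
        using \<open>1 \<le> sqrt N\<close> by (simp add: L_def)
    qed simp
  qed
  moreover have "real n * \<mu> = 0 \<or> real n * \<mu> \<ge> 1" for n
  proof (cases "n = 0")
    case False
    obtain a :: nat where P: "potter_bounds L ((\<tau> - 2) / 2) (exp (real a))"
      using slowly_varying_potter_bounds[OF L_sv L L_meas, of "(\<tau> - 2) / 2"] assms(2) by auto
    have "\<mu> \<ge> 1"
      unfolding assms(8)
      by (rule expectation_weight_ge_1[OF assms(7)[of 0, folded wL] P _ _ L])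
         (use assms(2) in \<open>auto simp: field_simps\<close>)
    hence "1 * 1 \<le> real n * \<mu>" using False by (intro mult_mono) auto
    thus ?thesis by simp
  qed simp
  ultimately have eq: "(LINT h:{sqrt (real n * \<mu>)..real n * \<mu>}|lborel.
         1 / h * (l h ^ m * l (real n * \<mu> / h) ^ m / l (sqrt (real n * \<mu>)) ^ k))
      = (LINT h:{sqrt (real n * \<mu>)..real n * \<mu>}|lborel.
         1 / h * (L h ^ m * L (real n * \<mu> / h) ^ m / L (sqrt (real n * \<mu>)) ^ k))" for n
    by blast
  show ?thesis
    unfolding m_def[symmetric] eq
    unfolding m(1)
    by (rule avg_cycles_gtrsim[OF assms(2) L_sv L L_meas assms(6) assms(7)[folded wL] assms(8) m(2)])
qed

end
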